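(* Let $k>d$, let $\mathbf{W}^*\in\mathbb{R}^{k\times d}$ with $\sigma_{\min}(\mathbf{W}^* )>0$, and let $\mathbf{v}^*\in\mathbb{R}^k$ have nonnegative entries. Let $\mathbf{x}_1,\dots,\mathbf{x}_n$ be i.i.d. $\mathcal{N}(\mathbf{0},\mathbf{I}_d)$ and $y_i=\langle \mathbf{v}^*,\phi(\mathbf{W}^*\mathbf{x}_i)\rangle$ with $\phi(z)=z^2$ applied entrywise. Fix $\nu>0$, set $\mathbf{v}=\nu\mathbf{1}\in\mathbb{R}^k$, and let $\mathcal{L}(\mathbf{W})=\frac{1}{2n}\sum_{i=1}^n(y_i-\mathbf{v}^T\phi(\mathbf{W}\mathbf{x}_i))^2$. There are numerical constants $c,C,\gamma>0$ such that if $c\,d\log d\le n\le C d^2$, then with probability at least $1-12de^{-\gamma d}-8/d$ the following holds: for all $\epsilon_g,\epsilon_H\ge 0$, every $\mathbf{W}\in\mathbb{R}^{k\times d}$ satisfying $$\|\nabla\mathcal{L}(\mathbf{W})\|_F\le\epsilon_g\quad\text{and}\quad \nabla^2\mathcal{L}(\mathbf{W})\succeq-\epsilon_H\mathbf{I}$$ obeys $$\mathcal{L}(\mathbf{W})\le\frac{\epsilon_g}{\sqrt{\nu}}\max\Big(\sqrt{1+14\|{\mathbf{W}^*}^T\mathbf{D}_{\mathbf{v}^*}\mathbf{W}^*\|_*},\,4\frac{\epsilon_g}{\sqrt{\nu}}\Big)+\frac{\epsilon_H}{2\nu}\|{\mathbf{W}^*}^T\mathbf{D}_{\mathbf{v}^*}\mathbf{W}^*\|_*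 .$$
   Context: $\mathbf{D}_{\mathbf{v}^*}=\mathrm{diag}(\mathbf{v}^* )$; $\|\cdot\|_*$ is the nuclear norm (sum of singular values); $\|\cdot\|_F$ the Frobenius norm; $\nabla\mathcal{L}$ and $\nabla^2\mathcal{L}$ are the gradient and Hessian with respect to $\mathrm{vect}(\mathbf{W})$; $\mathbf{1}$ is the all-ones vector. *)

theory Defs
  imports "HOL-Probability.Probability"
begin

text \<open>Matrices are represented as functions nat => nat => real, with explicit
dimensions (entries outside the index ranges are irrelevant).\<close>

text \<open>Standard Gaussian on the real line, and the law of n i.i.d. N(0, I_d) samples:
X i l is coordinate l of sample i.\<close>
definition std_gauss :: "real measure" where
  "std_gauss = density lborel std_normal_density"

definition gauss_samples :: "nat \<Rightarrow> nat \<Rightarrow> (nat \<Rightarrow> nat \<Rightarrow> real) measure" where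
  "gauss_samples n d = PiM {..<n} (\<lambda>_. PiM {..<d} (\<lambda>_. std_gauss))"

definition is_svd :: "nat \<Rightarrow> nat \<Rightarrow> (nat \<Rightarrow> nat \<Rightarrow> real) \<Rightarrow> (nat \<Rightarrow> real)
     \<Rightarrow> (nat \<Rightarrow> nat \<Rightarrow> real) \<Rightarrow> (nat \<Rightarrow> nat \<Rightarrow> real) \<Rightarrow> bool" where
  "is_svd m n M s U V \<longleftrightarrow>
     (\<forall>i<min m n. s i \<ge> 0) \<and>
     (\<forall>i<min m n. \<forall>i'<min m n. (\<Sum>a<m. U a i * U a i') = (if i = i' then 1 else 0)) \<and>
     (\<forall>i<min m n. \<forall>i'<min m n. (\<Sum>b<n. V b i * V b i') = (if i = i' then 1 else 0)) \<and>
     (\<forall>a<m. \<forall>b<n. M a b = (\<Sum>i<min m n. U a i * s i * V b i))"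

definition sigma_min :: "nat \<Rightarrow> nat \<Rightarrow> (nat \<Rightarrow> nat \<Rightarrow> real) \<Rightarrow> real" where
  "sigma_min m n M = (SOME x. \<exists>s U V. is_svd m n M s U V \<and> x = Min (s ` {..<min m n}))"

definition nuclear_norm :: "nat \<Rightarrow> nat \<Rightarrow> (nat \<Rightarrow> nat \<Rightarrow> real) \<Rightarrow> real" where
  "nuclear_norm m n M = (SOME x. \<exists>s U V. is_svd m n M s U V \<and> x = (\<Sum>i<min m n. s i))"

definition WtDW :: "nat \<Rightarrow> (nat \<Rightarrow> nat \<Rightarrow> real) \<Rightarrow> (nat \<Rightarrow> real) \<Rightarrow> (nat \<Rightarrow> nat \<Rightarrow> real)" where
  "WtDW k Ws vs = (\<lambda>a b. \<Sum>j<k. Ws j a * vs j * Ws j b)"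

definition label :: "nat \<Rightarrow> nat \<Rightarrow> (nat \<Rightarrow> nat \<Rightarrow> real) \<Rightarrow> (nat \<Rightarrow> real)
     \<Rightarrow> (nat \<Rightarrow> nat \<Rightarrow> real) \<Rightarrow> nat \<Rightarrow> real" where
  "label k d Ws vs X i = (\<Sum>j<k. vs j * (\<Sum>l<d. Ws j l * X i l)\<^sup>2)"

definition loss :: "nat \<Rightarrow> nat \<Rightarrow> nat \<Rightarrow> (nat \<Rightarrow> nat \<Rightarrow> real) \<Rightarrow> (nat \<Rightarrow> real) \<Rightarrow> real
     \<Rightarrow> (nat \<Rightarrow> nat \<Rightarrow> real) \<Rightarrow> (nat \<Rightarrow> nat \<Rightarrow> real) \<Rightarrow> real" where
  "loss k d n Ws vs \<nu> X W =
     1 / (2 * real n) * (\<Sum>i<n. (label k d Ws vs X i - (\<Sum>j<k. \<nu> * (\<Sum>l<d. W j l * X i l)\<^sup>2))\<^sup>2)"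

definition mat_pert :: "(nat \<Rightarrow> nat \<Rightarrow> real) \<Rightarrow> nat \<Rightarrow> nat \<Rightarrow> real \<Rightarrow> (nat \<Rightarrow> nat \<Rightarrow> real)" where
  "mat_pert W j l t = (\<lambda>a b. if a = j \<and> b = l then W a b + t else W a b)"

definition partial_entry :: "((nat \<Rightarrow> nat \<Rightarrow> real) \<Rightarrow> real) \<Rightarrow> (nat \<Rightarrow> nat \<Rightarrow> real) \<Rightarrow> nat \<Rightarrow> nat \<Rightarrow> real" where
  "partial_entry f W j l = deriv (\<lambda>t. f (mat_pert W j l t)) 0"

definition hessian_entry :: "((nat \<Rightarrow> nat \<Rightarrow> real) \<Rightarrow> real) \<Rightarrow> (nat \<Rightarrow> nat \<Rightarrow> real)
     \<Rightarrow> nat \<Rightarrow> nat \<Rightarrow> nat \<Rightarrow> nat \<Rightarrow> real" where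
  "hessian_entry f W j l j' l' = partial_entry (\<lambda>V. partial_entry f V j l) W j' l'"

definition grad_frob :: "nat \<Rightarrow> nat \<Rightarrow> ((nat \<Rightarrow> nat \<Rightarrow> real) \<Rightarrow> real) \<Rightarrow> (nat \<Rightarrow> nat \<Rightarrow> real) \<Rightarrow> real" where
  "grad_frob k d f W = sqrt (\<Sum>j<k. \<Sum>l<d. (partial_entry f W j l)\<^sup>2)"

definition hessian_ge :: "nat \<Rightarrow> nat \<Rightarrow> ((nat \<Rightarrow> nat \<Rightarrow> real) \<Rightarrow> real) \<Rightarrow> (nat \<Rightarrow> nat \<Rightarrow> real) \<Rightarrow> real \<Rightarrow> bool" where
  "hessian_ge k d f W eps \<longleftrightarrow>
     (\<forall>U. (\<Sum>j<k. \<Sum>l<d. \<Sum>j'<k. \<Sum>l'<d. U j l * (hessian_entry f W j l j' l' + (if j = j' \<and> l = l' then eps else 0)) * U j' l') \<ge> 0)"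

end

theory Submission
  imports Defs
begin

text \<open>Write \<open>P = \<nu> W\<^sup>T W\<close>, \<open>M = W*\<^sup>T D W*\<close>, \<open>r\<^sub>i = x\<^sub>i\<^sup>T (P - M) x\<^sub>i\<close> and \<open>A = (1/n) \<Sum>\<^sub>i r\<^sub>i x\<^sub>i x\<^sub>i\<^sup>T\<close>, so
  that the loss is \<open>\<langle>A, P - M\<rangle> / 2\<close> and its gradient is \<open>2 \<nu> W A\<close>. Hence \<open>\<langle>A, P\<rangle>\<close> is at most
  \<open>\<epsilon>g / 2\<close> times the Frobenius norm of \<open>W\<close>. As \<open>k > d\<close>, there is a unit vector \<open>a\<close> with
  \<open>W\<^sup>T a = 0\<close>; testing the Hessian on \<open>a b\<^sup>T\<close> gives \<open>A \<ge> - \<epsilon>H / (2 \<nu>)\<close>, which bounds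
  \<open>- \<langle>A, M\<rangle>\<close> by \<open>\<epsilon>H / (2 \<nu>)\<close> times the trace of \<open>M\<close>.

  The Frobenius norm of \<open>W\<close> is controlled through \<open>\<langle>A, P\<rangle>\<close> as well: the mean square of the
  network outputs is at least the square of \<open>\<langle>\<Sigma>, P\<rangle>\<close>, where \<open>\<Sigma>\<close> is the sample covariance, and the
  mean square of the labels is at most \<open>12 (tr M)\<^sup>2\<close> by Chebyshev's inequality. Only the lower
  bound \<open>\<Sigma> \<ge> 1/10\<close> is needed. Lower tails of Gaussian sums of squares are exponentially small, so
  a union bound over a grid of mesh \<open>1 / (10 d\<^sup>2)\<close> suffices once \<open>n \<ge> 100 d ln d\<close>.\<close>

section \<open>Singular values of positive semidefinite matrices\<close>

text \<open>Gaussian elimination, by induction on the number of equations: a pivot \<open>p\<close>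
  in equation \<open>m\<close> is eliminated from the others, which leaves one equation and one
  unknown fewer. It supplies vectors orthogonal to a short list, dependences among d + 1 vectors,
  and a kernel vector of the transpose of \<open>W\<close>.\<close>

lemma homogeneous_system_nontrivial:
  fixes M :: "nat \<Rightarrow> 'b \<Rightarrow> real"
  assumes "finite J" "m < card J"
  shows "\<exists>a. (\<exists>j\<in>J. a j \<noteq> 0) \<and> (\<forall>l<m. (\<Sum>j\<in>J. M l j * a j) = 0)"
  using assms
proof (induction m arbitrary: J M)
  case 0
  then have "J \<noteq> {}" by auto
  then show ?case by (intro exI[of _ "\<lambda>_. 1"]) auto
next
  case (Suc m)
  show ?case
  proof (cases "\<forall>j\<in>J. M m j = 0")
    case True
    obtain a where "\<exists>j\<in>J. a j \<noteq> 0" "\<forall>l<m. (\<Sum>j\<in>J. M l j * a j) = 0"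
      using Suc.IH[of J M] Suc.prems by auto
    then show ?thesis using True by (intro exI[of _ a]) (auto simp: less_Suc_eq)
  next
    case False
    then obtain p where p: "p \<in> J" "M m p \<noteq> 0" by auto
    define J' where "J' = J - {p}"
    have J': "finite J'" "m < card J'" "p \<notin> J'" "J = insert p J'"
      using Suc.prems p by (auto simp: J'_def)
    obtain a where a: "\<exists>j\<in>J'. a j \<noteq> 0"
        "\<forall>l<m. (\<Sum>j\<in>J'. (M l j - M l p * M m j / M m p) * a j) = 0"
      using Suc.IH[OF J'(1,2), of "\<lambda>l j. M l j - M l p * M m j / M m p"] by auto
    \<comment> \<open>The value at the pivot is the one that solves equation \<open>m\<close>; the
      reduced coefficients then make the other equations hold as well.\<close>
    define a' where "a' = a(p := - (\<Sum>j\<in>J'. M m j * a j) / M m p)"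
    have sum_a': "(\<Sum>j\<in>J. M l j * a' j) =
        - M l p * (\<Sum>j\<in>J'. M m j * a j) / M m p + (\<Sum>j\<in>J'. M l j * a j)" for l
    proof -
      have "(\<Sum>j\<in>J'. M l j * a' j) = (\<Sum>j\<in>J'. M l j * a j)"
        using J'(3) by (intro sum.cong) (auto simp: a'_def)
      then show ?thesis using J' by (simp add: a'_def)
    qed
    have "(\<Sum>j\<in>J. M l j * a' j) = 0" if "l < Suc m" for l
    proof (cases "l = m")
      case True
      then show ?thesis using p sum_a'[of m] by simp
    next
      case False
      then have "l < m" using that by simp
      then have "(\<Sum>j\<in>J'. M l j * a j) = (\<Sum>j\<in>J'. M l p * M m j / M m p * a j)"
        using a(2) by (simp add: left_diff_distrib sum_subtractf)
      then show ?thesis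
        unfolding sum_a' by (simp add: sum_distrib_left sum_divide_distrib sum_negf mult_ac)
    qed
    moreover have "\<exists>j\<in>J. a' j \<noteq> 0" using a(1) J' by (auto simp: a'_def)
    ultimately show ?thesis by blast
  qed
qed

section \<open>Inner products and matrix-vector products that see only the first d
  coordinates\<close>

definition ip :: "nat \<Rightarrow> (nat \<Rightarrow> real) \<Rightarrow> (nat \<Rightarrow> real) \<Rightarrow> real" where
  "ip d x y = (\<Sum>l<d. x l * y l)"

definition mat_vec :: "nat \<Rightarrow> (nat \<Rightarrow> nat \<Rightarrow> real) \<Rightarrow> (nat \<Rightarrow> real) \<Rightarrow> nat \<Rightarrow> real" where
  "mat_vec d M x = (\<lambda>a. \<Sum>b<d. M a b * x b)"

lemma ip_commute: "ip d x y = ip d y x"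
  by (simp add: ip_def mult.commute)

lemma ip_cong: "(\<And>l. l < d \<Longrightarrow> x l = x' l) \<Longrightarrow> (\<And>l. l < d \<Longrightarrow> y l = y' l) \<Longrightarrow> ip d x y = ip d x' y'"
  by (simp add: ip_def)

lemma mat_vec_cong: "(\<And>l. l < d \<Longrightarrow> x l = x' l) \<Longrightarrow> mat_vec d M x = mat_vec d M x'"
  by (simp add: mat_vec_def)

lemma ip_add_scaled_left: "ip d (\<lambda>l. x l + t * z l) y = ip d x y + t * ip d z y"
  by (simp add: ip_def sum.distrib sum_distrib_left algebra_simps)

lemma ip_add_scaled_right: "ip d y (\<lambda>l. x l + t * z l) = ip d y x + t * ip d y z"
  by (simp add: ip_def sum.distrib sum_distrib_left algebra_simps)

lemma ip_scale_left: "ip d (\<lambda>l. t * x l) y = t * ip d x y"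
  by (simp add: ip_def sum_distrib_left algebra_simps)

lemma ip_scale_right: "ip d y (\<lambda>l. t * x l) = t * ip d y x"
  by (simp add: ip_def sum_distrib_left algebra_simps)

lemma mat_vec_add_scaled: "mat_vec d M (\<lambda>l. x l + t * z l) = (\<lambda>l. mat_vec d M x l + t * mat_vec d M z l)"
  by (simp add: mat_vec_def sum.distrib sum_distrib_left algebra_simps)

lemma mat_vec_scale: "mat_vec d M (\<lambda>l. t * x l) = (\<lambda>l. t * mat_vec d M x l)"
  by (simp add: mat_vec_def sum_distrib_left algebra_simps)

lemma ip_self_nonneg: "0 \<le> ip d x x"
  by (simp add: ip_def sum_nonneg)

lemma ip_self_eq_0: "ip d x x = 0 \<Longrightarrow> l < d \<Longrightarrow> x l = 0"
  by (simp add: ip_def sum_nonneg_eq_0_iff)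

lemma ip_mat_vec_sym:
  assumes "\<And>a b. a < d \<Longrightarrow> b < d \<Longrightarrow> M a b = M b a"
  shows "ip d x (mat_vec d M y) = ip d y (mat_vec d M x)"
proof -
  have "ip d x (mat_vec d M y) = (\<Sum>a<d. \<Sum>b<d. x a * M a b * y b)"
    by (simp add: ip_def mat_vec_def sum_distrib_left mult_ac)
  also have "\<dots> = (\<Sum>b<d. \<Sum>a<d. x a * M a b * y b)"
    by (rule sum.swap)
  also have "\<dots> = ip d y (mat_vec d M x)"
    unfolding ip_def mat_vec_def sum_distrib_left using assms by (intro sum.cong) auto
  finally show ?thesis .
qed

section \<open>Spectral decomposition of symmetric matrices by successive maximisation\<close>

lemma nonneg_quadratic_linear_coeff_0:
  fixes B C :: real
  assumes "\<And>t. 0 \<le> 2 * t * B + t\<^sup>2 * C"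
  shows "B = 0"
proof (rule ccontr)
  assume "B \<noteq> 0"
  \<comment> \<open>As D exceeds C and is positive, the point t = - B / D lies close enough to 0 for
    the linear term to dominate, so the quadratic is negative there.\<close>
  define D where "D = \<bar>C\<bar> + 1"
  have D: "D > 0" "C < D" by (auto simp: D_def)
  have "2 * (- B / D) * B + (- B / D)\<^sup>2 * C = B\<^sup>2 / D * (C / D - 2)"
    using D by (simp add: power2_eq_square field_simps)
  moreover have "B\<^sup>2 / D > 0" using \<open>B \<noteq> 0\<close> D by simp
  moreover have "C / D - 2 < 0" using D by (simp add: field_simps)
  ultimately have "2 * (- B / D) * B + (- B / D)\<^sup>2 * C < 0"
    by (metis mult_pos_neg)
  then show False using assms[of "- B / D"] by simp
qed

text \<open>The maximiser of the quadratic form on the unit sphere of the orthogonal complement of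
  the eigenvectors found so far is the next eigenvector.\<close>

lemma extend_orthonormal_eigenvectors:
  fixes M :: "nat \<Rightarrow> nat \<Rightarrow> real"
  assumes sym: "\<And>a b. a < d \<Longrightarrow> b < d \<Longrightarrow> M a b = M b a"
    and "m < d"
    and eig: "\<And>i a. i < m \<Longrightarrow> a < d \<Longrightarrow> mat_vec d M (u i) a = lam i * u i a"
  shows "\<exists>x \<mu>. ip d x x = 1 \<and> (\<forall>i<m. ip d (u i) x = 0) \<and> (\<forall>a<d. mat_vec d M x a = \<mu> * x a)"
proof -
  define f where "f x = ip d x (mat_vec d M x)" for x
  \<comment> \<open>Coordinates from d on are pinned to 0, so that the box is compact in the product
    topology on all sequences, by Tychonoff.\<close>
  define box :: "(nat \<Rightarrow> real) set" where "box = PiE UNIV (\<lambda>l. if l < d then {-1..1} else {0})"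
  define K where "K = box \<inter> {x. ip d x x = 1} \<inter> (\<Inter>i\<in>{..<m}. {x. ip d (u i) x = 0})"
  have "compactin (product_topology (\<lambda>i::nat. euclidean::real topology) UNIV) box"
    unfolding box_def compactin_PiE by auto
  then have "compact box" by (simp add: euclidean_product_topology)
  have cont_ip: "continuous_on UNIV (\<lambda>x. ip d (g x) (h x))"
    if "\<And>l. continuous_on UNIV (\<lambda>x. g x l)" "\<And>l. continuous_on UNIV (\<lambda>x. h x l)"
    for g h :: "(nat \<Rightarrow> real) \<Rightarrow> nat \<Rightarrow> real"
    unfolding ip_def using that by (intro continuous_intros)
  have "compact K"
    unfolding K_def
    by (intro compact_Int_closed \<open>compact box\<close> closed_INT ballI closed_Collect_eq cont_ip
        continuous_intros) auto
  have in_K: "(\<lambda>l. if l < d then y l / sqrt (ip d y y) else 0) \<in> K"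
    if y: "ip d y y \<noteq> 0" "\<And>i. i < m \<Longrightarrow> ip d (u i) y = 0" for y
  proof -
    let ?y = "\<lambda>l. if l < d then y l / sqrt (ip d y y) else 0"
    have pos: "ip d y y > 0" using y ip_self_nonneg[of d y] by simp
    have eq: "ip d z ?y = 1 / sqrt (ip d y y) * ip d z y" for z
      unfolding ip_scale_right[symmetric] by (rule ip_cong) auto
    have "ip d ?y ?y = 1 / sqrt (ip d y y) * (1 / sqrt (ip d y y) * ip d y y)"
      by (metis eq ip_commute)
    then have one: "ip d ?y ?y = 1" using pos by (simp add: field_simps)
    have "\<bar>?y l\<bar> \<le> 1" if "l < d" for l
    proof -
      have "(?y l)\<^sup>2 \<le> ip d ?y ?y"
        unfolding ip_def power2_eq_square using that
        by (intro member_le_sum) auto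
      then show ?thesis unfolding one by (simp add: abs_square_le_1)
    qed
    then have "?y l \<in> {-1..1}" if "l < d" for l
      using that by (metis abs_le_iff atLeastAtMost_iff minus_le_iff)
    then have "?y \<in> box" by (auto simp: box_def)
    then show ?thesis using one eq y(2) by (auto simp: K_def)
  qed
  obtain z where z: "\<exists>j\<in>{..<d}. z j \<noteq> 0" "\<forall>i<m. (\<Sum>j<d. u i j * z j) = 0"
    using homogeneous_system_nontrivial[of "{..<d}" m u] \<open>m < d\<close> by auto
  have "K \<noteq> {}"
  proof -
    have "ip d z z \<noteq> 0" using z(1) ip_self_eq_0[of d z] by auto
    moreover have "ip d (u i) z = 0" if "i < m" for i using z(2) that by (simp add: ip_def)
    ultimately show ?thesis using in_K[of z] by blast
  qed
  have "continuous_on K f"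
    unfolding f_def mat_vec_def
    by (rule continuous_on_subset[OF cont_ip]) (auto intro!: continuous_intros)
  then obtain x where x: "x \<in> K" "\<And>y. y \<in> K \<Longrightarrow> f y \<le> f x"
    using continuous_attains_sup[OF \<open>compact K\<close> \<open>K \<noteq> {}\<close>] by blast
  have x1: "ip d x x = 1" and xu: "\<And>i. i < m \<Longrightarrow> ip d (u i) x = 0"
    using x(1) by (auto simp: K_def)
  have f_scale: "f (\<lambda>l. t * y l) = t\<^sup>2 * f y" for t y
    by (simp add: f_def mat_vec_scale ip_scale_left ip_scale_right power2_eq_square)
  have f_cong: "f y = f y'" if "\<And>l. l < d \<Longrightarrow> y l = y' l" for y y'
    using that unfolding f_def by (metis ip_cong mat_vec_cong)
  \<comment> \<open>The homogeneous form of maximality: competitors need not be normalised, so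
    \<open>x\<close> can be perturbed linearly.\<close>
  have f_le: "f y \<le> f x * ip d y y" if y: "\<And>i. i < m \<Longrightarrow> ip d (u i) y = 0" for y
  proof (cases "ip d y y = 0")
    case True
    then have "f y = 0" unfolding f_def ip_def[of d y "mat_vec d M y"] using ip_self_eq_0[OF True] by simp
    then show ?thesis using True by simp
  next
    case False
    then have pos: "ip d y y > 0" using ip_self_nonneg[of d y] by simp
    have "f (\<lambda>l. if l < d then y l / sqrt (ip d y y) else 0) = f (\<lambda>l. 1 / sqrt (ip d y y) * y l)"
      by (rule f_cong) auto
    also have "\<dots> = f y / ip d y y"
      unfolding f_scale using pos by (simp add: power_divide)
    finally have "f y / ip d y y \<le> f x" using x(2)[OF in_K[OF False y]] by simp
    then show ?thesis using pos by (simp add: field_simps)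
  qed
  \<comment> \<open>The residual of the eigenvector equation. It is orthogonal to the earlier
    \<open>u i\<close>, so x + t z is an admissible competitor for every t; the first-order
    condition then says that its squared norm is 0.\<close>
  define z where "z = (\<lambda>l. mat_vec d M x l + (- f x) * x l)"
  have zu: "ip d (u i) z = 0" if "i < m" for i
  proof -
    have "ip d (u i) (mat_vec d M x) = ip d x (mat_vec d M (u i))"
      by (rule ip_mat_vec_sym[OF sym])
    also have "\<dots> = ip d x (\<lambda>l. lam i * u i l)"
      by (rule ip_cong) (use eig that in auto)
    also have "\<dots> = 0"
      by (simp add: ip_scale_right ip_commute[of d x] xu that)
    finally show ?thesis unfolding z_def ip_add_scaled_right using xu that by simp
  qed
  have "f x * ip d x z - ip d z (mat_vec d M x) = 0"
  proof (rule nonneg_quadratic_linear_coeff_0)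
    fix t
    have "f (\<lambda>l. x l + t * z l) \<le> f x * ip d (\<lambda>l. x l + t * z l) (\<lambda>l. x l + t * z l)"
      by (rule f_le) (simp add: ip_add_scaled_right xu zu)
    moreover have "ip d x (mat_vec d M z) = ip d z (mat_vec d M x)"
      by (rule ip_mat_vec_sym[OF sym])
    ultimately show "0 \<le> 2 * t * (f x * ip d x z - ip d z (mat_vec d M x))
        + t\<^sup>2 * (f x * ip d z z - ip d z (mat_vec d M z))"
      unfolding f_def mat_vec_add_scaled ip_add_scaled_left ip_add_scaled_right
      by (simp add: x1 ip_commute[of d z x] power2_eq_square algebra_simps)
  qed
  moreover have "ip d z z = ip d z (mat_vec d M x) + (- f x) * ip d z x"
    by (subst (2) z_def) (rule ip_add_scaled_right)
  ultimately have "ip d z z = 0"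
    by (simp add: ip_commute[of d z x])
  then have "\<forall>a<d. mat_vec d M x a = f x * x a"
    using ip_self_eq_0[of d z] by (auto simp: z_def)
  then show ?thesis using x1 xu by blast
qed

lemma orthonormal_eigenvectors:
  fixes M :: "nat \<Rightarrow> nat \<Rightarrow> real"
  assumes sym: "\<And>a b. a < d \<Longrightarrow> b < d \<Longrightarrow> M a b = M b a" and "m \<le> d"
  shows "\<exists>u lam. (\<forall>i<m. \<forall>j<m. ip d (u i) (u j) = (if i = j then 1 else 0)) \<and>
    (\<forall>i<m. \<forall>a<d. mat_vec d M (u i) a = lam i * u i a)"
  using \<open>m \<le> d\<close>
proof (induction m)
  case 0
  then show ?case by simp
next
  case (Suc m)
  then obtain u lam where u: "\<forall>i<m. \<forall>j<m. ip d (u i) (u j) = (if i = j then 1 else 0)"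
    "\<forall>i<m. \<forall>a<d. mat_vec d M (u i) a = lam i * u i a" by auto
  obtain x \<mu> where "ip d x x = 1" "\<forall>i<m. ip d (u i) x = 0" "\<forall>a<d. mat_vec d M x a = \<mu> * x a"
  proof -
    have eig: "mat_vec d M (u i) a = lam i * u i a" if "i < m" "a < d" for i a
      using u(2) that by blast
    have "\<exists>x \<mu>. ip d x x = 1 \<and> (\<forall>i<m. ip d (u i) x = 0) \<and> (\<forall>a<d. mat_vec d M x a = \<mu> * x a)"
      by (rule extend_orthonormal_eigenvectors[where lam = lam])
        (use sym eig Suc.prems in simp_all)
    then show ?thesis using that by blast
  qed
  then show ?case using u
    by (intro exI[of _ "u(m := x)"] exI[of _ "lam(m := \<mu>)"]) (auto simp: less_Suc_eq ip_commute)
qed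

text \<open>The d + 1 vectors \<open>u 0\<close>, ..., \<open>u (d - 1)\<close>, \<open>r\<close> in
  dimension d are linearly dependent, and pairing a dependence with \<open>u i\<close> kills the
  coefficient of \<open>u i\<close>. The coefficient of \<open>r\<close> is therefore nonzero, which
  forces \<open>r\<close> to vanish.\<close>

lemma orthonormal_complete:
  assumes u: "\<And>i j. i < d \<Longrightarrow> j < d \<Longrightarrow> ip d (u i) (u j) = (if i = j then 1 else 0)"
    and "a < d" "b < d"
  shows "(\<Sum>i<d. u i a * u i b) = (if a = b then 1 else 0)"
proof -
  \<comment> \<open>The b-th unit vector minus its projection onto the span of the
    \<open>u i\<close>.\<close>
  define r where "r c = (if c = b then 1 else 0) - (\<Sum>i<d. u i c * u i b)" for c
  have ru: "ip d (u i) r = 0" if "i < d" for i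
  proof -
    have "ip d (u i) r = u i b - (\<Sum>c<d. \<Sum>j<d. u i c * u j c * u j b)"
      using \<open>b < d\<close>
      by (simp add: ip_def r_def right_diff_distrib sum_subtractf sum_distrib_left mult_ac
          if_distrib[of "\<lambda>x. _ * x"] cong: if_cong)
    also have "(\<Sum>c<d. \<Sum>j<d. u i c * u j c * u j b) = (\<Sum>j<d. ip d (u i) (u j) * u j b)"
      by (subst sum.swap) (simp add: ip_def sum_distrib_right)
    also have "\<dots> = (\<Sum>j<d. if i = j then u j b else 0)"
      using that u by (intro sum.cong) auto
    also have "\<dots> = u i b" using that by simp
    finally show ?thesis by simp
  qed
  obtain c where c: "\<exists>j\<in>{..<Suc d}. c j \<noteq> 0"
    "\<forall>l<d. (\<Sum>j<Suc d. (if j < d then u j l else r l) * c j) = 0"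
    using homogeneous_system_nontrivial[of "{..<Suc d}" d "\<lambda>l j. if j < d then u j l else r l"]
    by auto
  have c2: "(\<Sum>j<d. u j l * c j) + r l * c d = 0" if "l < d" for l
    using c(2) that by simp
  have "c i = 0" if "i < d" for i
  proof -
    have "0 = (\<Sum>l<d. u i l * ((\<Sum>j<d. u j l * c j) + r l * c d))"
      using c2 by simp
    also have "\<dots> = (\<Sum>l<d. \<Sum>j<d. u i l * u j l * c j) + ip d (u i) r * c d"
      by (simp add: ip_def ring_distribs sum.distrib sum_distrib_left sum_distrib_right mult_ac)
    also have "(\<Sum>l<d. \<Sum>j<d. u i l * u j l * c j) = (\<Sum>j<d. ip d (u i) (u j) * c j)"
      by (subst sum.swap) (simp add: ip_def sum_distrib_right)
    also have "\<dots> = (\<Sum>j<d. if i = j then c j else 0)"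
      using that u by (intro sum.cong) auto
    finally show ?thesis using that ru by simp
  qed
  then have "c d \<noteq> 0" "r a * c d = 0"
    using c(1) c2[OF \<open>a < d\<close>] by (auto simp: less_Suc_eq)
  then show ?thesis by (simp add: r_def)
qed

text \<open>Eigenvectors serve as both left and right singular vectors, since the eigenvalues are
  nonnegative. Existence of a decomposition is what gives meaning to the choice operator in
  \<open>nuclear_norm\<close>.\<close>

lemma psd_is_svd:
  fixes M :: "nat \<Rightarrow> nat \<Rightarrow> real"
  assumes sym: "\<And>a b. a < d \<Longrightarrow> b < d \<Longrightarrow> M a b = M b a"
    and psd: "\<And>x. 0 \<le> ip d x (mat_vec d M x)"
  shows "\<exists>s U V. is_svd d d M s U V"
proof -
  obtain u lam where u: "\<And>i j. i < d \<Longrightarrow> j < d \<Longrightarrow> ip d (u i) (u j) = (if i = j then 1 else 0)"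
    and eig: "\<And>i a. i < d \<Longrightarrow> a < d \<Longrightarrow> mat_vec d M (u i) a = lam i * u i a"
  proof -
    have "\<exists>u lam. (\<forall>i<d. \<forall>j<d. ip d (u i) (u j) = (if i = j then 1 else 0)) \<and>
      (\<forall>i<d. \<forall>a<d. mat_vec d M (u i) a = lam i * u i a)"
      by (rule orthonormal_eigenvectors[OF sym order_refl])
    then show ?thesis using that by blast
  qed
  have "lam i \<ge> 0" if "i < d" for i
  proof -
    have "ip d (u i) (mat_vec d M (u i)) = ip d (u i) (\<lambda>a. lam i * u i a)"
      by (rule ip_cong) (use eig that in auto)
    then show ?thesis using psd[of "u i"] u that by (simp add: ip_scale_right)
  qed
  moreover have "M a b = (\<Sum>i<d. u i a * lam i * u i b)" if "a < d" "b < d" for a b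
  proof -
    have "M a b = (\<Sum>c<d. M a c * (if c = b then 1 else 0))"
      using that by (simp add: if_distrib[of "\<lambda>x. _ * x"] cong: if_cong)
    also have "\<dots> = (\<Sum>c<d. M a c * (\<Sum>i<d. u i c * u i b))"
      using orthonormal_complete[of d u] u that by (intro sum.cong) auto
    also have "\<dots> = (\<Sum>i<d. mat_vec d M (u i) a * u i b)"
      by (subst sum_distrib_left, subst sum.swap)
        (simp add: mat_vec_def sum_distrib_left sum_distrib_right mult_ac)
    finally show ?thesis using eig that by (simp add: mult_ac)
  qed
  ultimately have "is_svd d d M lam (\<lambda>a i. u i a) (\<lambda>a i. u i a)"
    using u by (simp add: is_svd_def ip_def)
  then show ?thesis by blast
qed

text \<open>\<open>nuclear_norm\<close> picks an arbitrary decomposition, so the argument works for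
  all of them: the trace is the sum of the singular values weighted by the inner products of left
  and right singular vectors, and these are at most 1.\<close>

lemma trace_le_nuclear_norm:
  fixes M :: "nat \<Rightarrow> nat \<Rightarrow> real"
  assumes sym: "\<And>a b. a < d \<Longrightarrow> b < d \<Longrightarrow> M a b = M b a"
    and psd: "\<And>x. 0 \<le> ip d x (mat_vec d M x)"
  shows "(\<Sum>a<d. M a a) \<le> nuclear_norm d d M"
proof -
  have "\<exists>x s U V. is_svd d d M s U V \<and> x = (\<Sum>i<min d d. s i)"
    using psd_is_svd[OF sym psd] by blast
  from someI_ex[OF this] obtain s U V
    where svd: "is_svd d d M s U V" and nn: "nuclear_norm d d M = (\<Sum>i<d. s i)"
    unfolding nuclear_norm_def by auto
  have "(\<Sum>a<d. M a a) = (\<Sum>a<d. \<Sum>i<d. U a i * s i * V a i)"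
    using svd by (simp add: is_svd_def)
  also have "\<dots> = (\<Sum>i<d. s i * (\<Sum>a<d. U a i * V a i))"
    by (subst sum.swap) (simp add: sum_distrib_left mult_ac)
  also have "\<dots> \<le> (\<Sum>i<d. s i * 1)"
  proof (intro sum_mono mult_left_mono)
    fix i assume i: "i \<in> {..<d}"
    have "2 * (\<Sum>a<d. U a i * V a i) = (\<Sum>a<d. 2 * U a i * V a i)"
      by (simp add: sum_distrib_left mult_ac)
    also have "\<dots> \<le> (\<Sum>a<d. U a i * U a i + V a i * V a i)"
      by (intro sum_mono) (use sum_squares_bound in \<open>simp add: power2_eq_square\<close>)
    also have "\<dots> = 2" using svd i by (simp add: is_svd_def sum.distrib)
    finally show "(\<Sum>a<d. U a i * V a i) \<le> 1" by simp
    show "0 \<le> s i" using svd i by (simp add: is_svd_def)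
  qed
  finally show ?thesis by (simp add: nn)
qed

section \<open>Trace and quadratic form of \<open>WtDW\<close>\<close>

lemma trace_WtDW: "(\<Sum>a<d. WtDW k Ws vs a a) = (\<Sum>j<k. vs j * ip d (Ws j) (Ws j))"
  unfolding WtDW_def ip_def
  by (subst sum.swap) (simp add: sum_distrib_left mult_ac)

lemma ip_mat_vec_WtDW: "ip d x (mat_vec d (WtDW k Ws vs) x) = (\<Sum>j<k. vs j * (ip d (Ws j) x)\<^sup>2)"
proof -
  have "ip d x (mat_vec d (WtDW k Ws vs) x) = (\<Sum>a<d. \<Sum>b<d. \<Sum>j<k. vs j * ((Ws j a * x a) * (Ws j b * x b)))"
    by (simp add: ip_def mat_vec_def WtDW_def sum_distrib_left sum_distrib_right mult_ac)
  also have "\<dots> = (\<Sum>j<k. \<Sum>a<d. \<Sum>b<d. vs j * ((Ws j a * x a) * (Ws j b * x b)))"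
    by (simp only: sum.swap[of _ "{..<k}"])
  also have "\<dots> = (\<Sum>j<k. vs j * (ip d (Ws j) x)\<^sup>2)"
    by (simp only: power2_eq_square ip_def sum_product) (simp only: sum_distrib_left)
  finally show ?thesis .
qed

lemma trace_le_nuclear_norm_WtDW:
  assumes "\<And>j. j < k \<Longrightarrow> 0 \<le> vs j"
  shows "(\<Sum>j<k. vs j * ip d (Ws j) (Ws j)) \<le> nuclear_norm d d (WtDW k Ws vs)"
  unfolding trace_WtDW[symmetric]
proof (rule trace_le_nuclear_norm)
  show "WtDW k Ws vs a b = WtDW k Ws vs b a" for a b
    by (simp add: WtDW_def mult_ac)
  show "0 \<le> ip d x (mat_vec d (WtDW k Ws vs) x)" for x
    unfolding ip_mat_vec_WtDW using assms by (intro sum_nonneg) auto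
qed

section \<open>The loss at approximate second-order stationary points\<close>

definition net_out :: "nat \<Rightarrow> nat \<Rightarrow> real \<Rightarrow> (nat \<Rightarrow> nat \<Rightarrow> real) \<Rightarrow> (nat \<Rightarrow> nat \<Rightarrow> real) \<Rightarrow> nat \<Rightarrow> real" where
  "net_out k d \<nu> X W i = (\<Sum>j<k. \<nu> * (ip d (W j) (X i))\<^sup>2)"

lemma label_eq_ip: "label k d Ws vs X i = (\<Sum>j<k. vs j * (ip d (Ws j) (X i))\<^sup>2)"
  by (simp add: label_def ip_def)

lemma loss_eq_net_out:
  "loss k d n Ws vs \<nu> X W = 1 / (2 * real n) * (\<Sum>i<n. (label k d Ws vs X i - net_out k d \<nu> X W i)\<^sup>2)"
  by (simp add: loss_def net_out_def ip_def)

section \<open>Gradient and Hessian of the loss\<close>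

lemma ip_mat_pert:
  assumes "l < d"
  shows "ip d (mat_pert W j l t a) x = ip d (W a) x + (if a = j then t * x l else 0)"
proof (cases "a = j")
  case True
  have "ip d (mat_pert W j l t a) x = (\<Sum>l'<d. W a l' * x l' + (if l' = l then t * x l else 0))"
    unfolding ip_def using True by (intro sum.cong) (auto simp: mat_pert_def algebra_simps)
  then show ?thesis using assms True by (simp add: sum.distrib ip_def)
qed (simp add: mat_pert_def ip_def)

lemma net_out_mat_pert:
  assumes "j < k" "l < d"
  shows "net_out k d \<nu> X (mat_pert W j l t) i =
    net_out k d \<nu> X W i + \<nu> * (2 * t * ip d (W j) (X i) * X i l + t\<^sup>2 * (X i l)\<^sup>2)"
proof -
  have "net_out k d \<nu> X (mat_pert W j l t) i =
    (\<Sum>a<k. \<nu> * (ip d (W a) (X i))\<^sup>2 +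
      (if a = j then \<nu> * (2 * t * ip d (W j) (X i) * X i l + t\<^sup>2 * (X i l)\<^sup>2) else 0))"
    unfolding net_out_def ip_mat_pert[OF assms(2)]
    by (intro sum.cong) (auto simp: power2_eq_square algebra_simps)
  then show ?thesis using assms by (simp add: sum.distrib net_out_def)
qed

lemma partial_entry_loss:
  assumes "j < k" "l < d"
  shows "partial_entry (loss k d n Ws vs \<nu> X) W j l =
    2 * \<nu> / n * (\<Sum>i<n. (net_out k d \<nu> X W i - label k d Ws vs X i) * ip d (W j) (X i) * X i l)"
proof -
  have "((\<lambda>t. \<Sum>i<n. (label k d Ws vs X i - net_out k d \<nu> X (mat_pert W j l t) i)\<^sup>2)
    has_field_derivative (\<Sum>i<n. - (2 * (label k d Ws vs X i - net_out k d \<nu> X W i) *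
        (\<nu> * (2 * ip d (W j) (X i) * X i l))))) (at 0)"
    unfolding net_out_mat_pert[OF assms]
    by (auto intro!: derivative_eq_intros sum.cong)
  from DERIV_cmult[OF this, of "1 / (2 * real n)"] show ?thesis
    unfolding partial_entry_def loss_eq_net_out
    by (subst DERIV_imp_deriv, assumption)
       (simp add: sum_distrib_left algebra_simps sum_subtractf sum_negf flip: sum_divide_distrib
         cong: sum.cong)
qed

lemma hessian_entry_loss:
  assumes "j < k" "l < d" "j' < k" "l' < d"
  shows "hessian_entry (loss k d n Ws vs \<nu> X) W j l j' l' =
    2 * \<nu> / n * (\<Sum>i<n. 2 * \<nu> * (ip d (W j) (X i) * X i l) * (ip d (W j') (X i) * X i l') +
      (if j = j' then (net_out k d \<nu> X W i - label k d Ws vs X i) * X i l * X i l' else 0))"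
proof -
  have pert: "ip d (mat_pert W j' l' t j) x = ip d (W j) x + t * (if j = j' then x l' else 0)" for t x
    using assms(4) by (simp add: ip_mat_pert)
  have "((\<lambda>t. \<Sum>i<n. (net_out k d \<nu> X (mat_pert W j' l' t) i - label k d Ws vs X i) *
      ip d (mat_pert W j' l' t j) (X i) * X i l) has_field_derivative
    (\<Sum>i<n. ((\<nu> * (2 * ip d (W j') (X i) * X i l')) * ip d (W j) (X i) +
      (net_out k d \<nu> X W i - label k d Ws vs X i) * (if j = j' then X i l' else 0)) * X i l)) (at 0)"
    unfolding net_out_mat_pert[OF assms(3,4)] pert
    by (auto intro!: derivative_eq_intros sum.cong)
  from DERIV_cmult[OF this, of "2 * \<nu> / n"] show ?thesis
    unfolding hessian_entry_def partial_entry_loss[OF assms(1,2)]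
    unfolding partial_entry_def[of "\<lambda>V. _ V"]
    by (subst DERIV_imp_deriv, assumption) (auto intro!: sum.cong simp: algebra_simps)
qed

text \<open>The squared sum is the Gauss-Newton part, which is never negative; the other part is the
  curvature of the network weighted by the residuals. Separating them allows test directions that
  isolate the second part.\<close>

lemma hessian_form_loss:
  fixes k d n Ws vs \<nu> X W U eps
  defines "r \<equiv> \<lambda>i. net_out k d \<nu> X W i - label k d Ws vs X i"
  shows "(\<Sum>j<k. \<Sum>l<d. \<Sum>j'<k. \<Sum>l'<d. U j l *
      (hessian_entry (loss k d n Ws vs \<nu> X) W j l j' l' + (if j = j' \<and> l = l' then eps else 0)) * U j' l') =
    2 * \<nu> / n * (\<Sum>i<n. 2 * \<nu> * (\<Sum>j<k. ip d (W j) (X i) * ip d (U j) (X i))\<^sup>2 +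
      r i * (\<Sum>j<k. (ip d (U j) (X i))\<^sup>2)) + eps * (\<Sum>j<k. ip d (U j) (U j))"
proof -
  define S where "S i = (\<Sum>j<k. ip d (W j) (X i) * ip d (U j) (X i))" for i
  define c where "c = 2 * \<nu> / n"
  have inner: "(\<Sum>j'<k. \<Sum>l'<d. U j l *
      (hessian_entry (loss k d n Ws vs \<nu> X) W j l j' l' + (if j = j' \<and> l = l' then eps else 0)) * U j' l') =
    c * (\<Sum>i<n. 2 * \<nu> * S i * (ip d (W j) (X i) * (U j l * X i l)) +
      r i * ip d (U j) (X i) * (U j l * X i l)) + eps * (U j l * U j l)"
    if j: "j < k" and l: "l < d" for j l
  proof -
    \<comment> \<open>The sums are carried out from the inside: over l' here, then over j'. The
      condition j = j' selects a single term in the residual part and in the \<open>eps\<close> part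
      only.\<close>
    have row: "(\<Sum>l'<d. U j l * (hessian_entry (loss k d n Ws vs \<nu> X) W j l j' l' +
        (if j = j' \<and> l = l' then eps else 0)) * U j' l') =
      c * (\<Sum>i<n. 2 * \<nu> * (ip d (W j) (X i) * (U j l * X i l)) * (ip d (W j') (X i) * ip d (U j') (X i)) +
        (if j = j' then r i * ip d (U j) (X i) * (U j l * X i l) else 0)) +
      (if j = j' then eps * (U j l * U j l) else 0)"
      if j': "j' < k" for j'
    proof -
      have "(\<Sum>l'<d. U j l * (hessian_entry (loss k d n Ws vs \<nu> X) W j l j' l' +
          (if j = j' \<and> l = l' then eps else 0)) * U j' l') =
        (\<Sum>l'<d. (\<Sum>i<n. c * (2 * \<nu> * (ip d (W j) (X i) * (U j l * X i l)) * (ip d (W j') (X i) * (U j' l' * X i l')) +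
          (if j = j' then r i * (U j' l' * X i l') * (U j l * X i l) else 0))) +
          (if l' = l then (if j = j' then eps * (U j l * U j l) else 0) else 0))"
        using j l j'
        by (intro sum.cong)
          (auto simp: hessian_entry_loss c_def r_def sum_distrib_left sum_distrib_right algebra_simps
            intro!: sum.cong)
      also have "\<dots> = (\<Sum>i<n. \<Sum>l'<d. c * (2 * \<nu> * (ip d (W j) (X i) * (U j l * X i l)) * (ip d (W j') (X i) * (U j' l' * X i l')) +
          (if j = j' then r i * (U j' l' * X i l') * (U j l * X i l) else 0))) +
          (if j = j' then eps * (U j l * U j l) else 0)"
        using l by (simp add: sum.distrib sum.swap[of _ "{..<n}"])
      also have "(\<Sum>i<n. \<Sum>l'<d. c * (2 * \<nu> * (ip d (W j) (X i) * (U j l * X i l)) * (ip d (W j') (X i) * (U j' l' * X i l')) +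
          (if j = j' then r i * (U j' l' * X i l') * (U j l * X i l) else 0))) =
        c * (\<Sum>i<n. 2 * \<nu> * (ip d (W j) (X i) * (U j l * X i l)) * (ip d (W j') (X i) * ip d (U j') (X i)) +
        (if j = j' then r i * ip d (U j) (X i) * (U j l * X i l) else 0))"
        unfolding sum_distrib_left[of c]
        by (intro sum.cong) (auto simp: ip_def sum.distrib sum_distrib_left sum_distrib_right distrib_left)
      finally show ?thesis .
    qed
    have "(\<Sum>j'<k. \<Sum>l'<d. U j l *
      (hessian_entry (loss k d n Ws vs \<nu> X) W j l j' l' + (if j = j' \<and> l = l' then eps else 0)) * U j' l') =
      c * (\<Sum>j'<k. \<Sum>i<n. 2 * \<nu> * (ip d (W j) (X i) * (U j l * X i l)) * (ip d (W j') (X i) * ip d (U j') (X i)) +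
        (if j = j' then r i * ip d (U j) (X i) * (U j l * X i l) else 0)) + eps * (U j l * U j l)"
      (is "?lhs = c * (\<Sum>j'<k. ?T j') + _")
    proof -
      have "?lhs = (\<Sum>j'<k. c * ?T j' + (if j = j' then eps * (U j l * U j l) else 0))"
        by (rule sum.cong) (simp_all only: row lessThan_iff)
      also have "\<dots> = (\<Sum>j'<k. c * ?T j') + eps * (U j l * U j l)"
        using j by (subst sum.distrib) simp
      finally show ?thesis by (simp only: sum_distrib_left[symmetric])
    qed
    also have "(\<Sum>j'<k. \<Sum>i<n. 2 * \<nu> * (ip d (W j) (X i) * (U j l * X i l)) * (ip d (W j') (X i) * ip d (U j') (X i)) +
        (if j = j' then r i * ip d (U j) (X i) * (U j l * X i l) else 0)) =
      (\<Sum>i<n. 2 * \<nu> * S i * (ip d (W j) (X i) * (U j l * X i l)) +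
        r i * ip d (U j) (X i) * (U j l * X i l))"
      using j by (subst sum.swap) (simp add: sum.distrib S_def sum_distrib_left sum_distrib_right mult_ac)
    finally show ?thesis .
  qed
  have "(\<Sum>j<k. \<Sum>l<d. \<Sum>j'<k. \<Sum>l'<d. U j l *
      (hessian_entry (loss k d n Ws vs \<nu> X) W j l j' l' + (if j = j' \<and> l = l' then eps else 0)) * U j' l') =
    c * (\<Sum>j<k. \<Sum>l<d. \<Sum>i<n. 2 * \<nu> * S i * (ip d (W j) (X i) * (U j l * X i l)) +
      r i * ip d (U j) (X i) * (U j l * X i l)) + eps * (\<Sum>j<k. \<Sum>l<d. U j l * U j l)"
  proof -
    have "(\<Sum>j<k. \<Sum>l<d. c * T j l + eps * E j l) =
      c * (\<Sum>j<k. \<Sum>l<d. T j l) + eps * (\<Sum>j<k. \<Sum>l<d. E j l)" for T E :: "nat \<Rightarrow> nat \<Rightarrow> real"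
      by (simp add: sum.distrib sum_distrib_left)
    from this[symmetric] show ?thesis
      by (simp only:) (intro sum.cong refl, simp only: inner lessThan_iff)
  qed
  also have "(\<Sum>j<k. \<Sum>l<d. \<Sum>i<n. 2 * \<nu> * S i * (ip d (W j) (X i) * (U j l * X i l)) +
      r i * ip d (U j) (X i) * (U j l * X i l)) =
    (\<Sum>i<n. \<Sum>j<k. \<Sum>l<d. 2 * \<nu> * S i * (ip d (W j) (X i) * (U j l * X i l)) +
      r i * ip d (U j) (X i) * (U j l * X i l))"
    by (simp only: sum.swap[of _ "{..<n}"])
  also have "\<dots> = (\<Sum>i<n. 2 * \<nu> * (S i)\<^sup>2 + r i * (\<Sum>j<k. (ip d (U j) (X i))\<^sup>2))"
  proof (rule sum.cong[OF refl])
    fix i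
    have "(\<Sum>j<k. \<Sum>l<d. 2 * \<nu> * S i * (ip d (W j) (X i) * (U j l * X i l)) +
        r i * ip d (U j) (X i) * (U j l * X i l)) =
      (\<Sum>j<k. 2 * \<nu> * S i * (ip d (W j) (X i) * ip d (U j) (X i)) +
        r i * ip d (U j) (X i) * ip d (U j) (X i))"
      unfolding sum.distrib sum_distrib_left[symmetric] ip_def[of d "U _" "X i", symmetric] ..
    also have "\<dots> = 2 * \<nu> * S i * S i + r i * (\<Sum>j<k. (ip d (U j) (X i))\<^sup>2)"
      by (simp add: sum.distrib S_def[of i] power2_eq_square sum_distrib_left mult_ac)
    finally show "(\<Sum>j<k. \<Sum>l<d. 2 * \<nu> * S i * (ip d (W j) (X i) * (U j l * X i l)) +
        r i * ip d (U j) (X i) * (U j l * X i l)) = 2 * \<nu> * (S i)\<^sup>2 + r i * (\<Sum>j<k. (ip d (U j) (X i))\<^sup>2)"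
      by (simp add: power2_eq_square)
  qed
  finally show ?thesis by (simp add: ip_def[of d "U _" "U _"] S_def c_def)
qed

text \<open>Since \<open>k > d\<close>, some nonzero \<open>a\<close> satisfies \<open>W\<^sup>T a = 0\<close>; along \<open>a b\<^sup>T\<close> the Gauss-Newton part
  of the Hessian vanishes.\<close>

lemma hessian_ge_imp_residual_form_ge:
  assumes "d < k" "0 < n" "0 < \<nu>" "hessian_ge k d (loss k d n Ws vs \<nu> X) W eps"
  shows "- (n * eps / (2 * \<nu>)) * ip d b b \<le>
    (\<Sum>i<n. (net_out k d \<nu> X W i - label k d Ws vs X i) * (ip d b (X i))\<^sup>2)"
proof -
  obtain a where a: "\<exists>j<k. a j \<noteq> 0" "\<forall>l<d. (\<Sum>j<k. W j l * a j) = 0"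
    using homogeneous_system_nontrivial[of "{..<k}" d "\<lambda>l j. W j l"] assms(1) by auto
  define U where "U = (\<lambda>j l. a j * b l)"
  define B where "B = (\<Sum>i<n. (net_out k d \<nu> X W i - label k d Ws vs X i) * (ip d b (X i))\<^sup>2)"
  have ip_U: "ip d (U j) x = a j * ip d b x" for j x
    by (simp add: U_def ip_scale_left)
  have "(\<Sum>j<k. ip d (W j) x * a j) = (\<Sum>l<d. (\<Sum>j<k. W j l * a j) * x l)" for x
    unfolding ip_def sum_distrib_right by (subst sum.swap) (simp add: mult_ac)
  then have "(\<Sum>j<k. ip d (W j) x * a j) = 0" for x
    using a(2) by simp
  then have cross: "(\<Sum>j<k. ip d (W j) x * (a j * ip d b x)) = 0" for x
    by (simp add: mult.assoc[symmetric] sum_distrib_right[symmetric])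
  have "(\<Sum>j<k. (a j)\<^sup>2) > 0"
    using a(1) by (auto intro!: sum_pos2)
  moreover have "0 \<le> (\<Sum>j<k. (a j)\<^sup>2) * (2 * \<nu> / n * B + eps * ip d b b)"
  proof -
    have "0 \<le> 2 * \<nu> / n * (\<Sum>i<n. (net_out k d \<nu> X W i - label k d Ws vs X i) *
        (\<Sum>j<k. (a j)\<^sup>2 * (ip d b (X i))\<^sup>2)) + eps * (\<Sum>j<k. (a j)\<^sup>2 * ip d b b)"
      using assms(4)[unfolded hessian_ge_def, rule_format, of U]
      unfolding hessian_form_loss ip_U
      by (simp add: cross power_mult_distrib) (simp add: U_def ip_scale_right power2_eq_square mult_ac)
    moreover have "(\<Sum>i<n. (net_out k d \<nu> X W i - label k d Ws vs X i) *
        (\<Sum>j<k. (a j)\<^sup>2 * (ip d b (X i))\<^sup>2)) = (\<Sum>j<k. (a j)\<^sup>2) * B"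
      unfolding B_def sum_distrib_right[symmetric] sum_distrib_left[of "\<Sum>j<k. (a j)\<^sup>2"]
      by (simp only: mult_ac)
    moreover have "(\<Sum>j<k. (a j)\<^sup>2 * ip d b b) = (\<Sum>j<k. (a j)\<^sup>2) * ip d b b"
      by (rule sum_distrib_right[symmetric])
    ultimately have "0 \<le> 2 * \<nu> / n * ((\<Sum>j<k. (a j)\<^sup>2) * B) + eps * ((\<Sum>j<k. (a j)\<^sup>2) * ip d b b)"
      by simp
    then show ?thesis by (simp only: distrib_left mult_ac)
  qed
  ultimately have "0 \<le> 2 * \<nu> / n * B + eps * ip d b b"
    by (simp add: zero_le_mult_iff)
  then show ?thesis
    unfolding B_def[symmetric] using assms(2,3) by (simp add: field_simps)
qed

text \<open>The network output is homogeneous of degree 2 in \<open>W\<close>, so by Euler's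
  identity the left side is n / 2 times the inner product of the gradient with \<open>W\<close>.
  Cauchy-Schwarz over all entries finishes.\<close>

lemma frob_gradient_bound:
  assumes "0 < n" "grad_frob k d (loss k d n Ws vs \<nu> X) W \<le> eps"
  shows "(\<Sum>i<n. (net_out k d \<nu> X W i - label k d Ws vs X i) * net_out k d \<nu> X W i)
    \<le> n / 2 * eps * sqrt (\<Sum>j<k. ip d (W j) (W j))"
proof -
  define r where "r i = net_out k d \<nu> X W i - label k d Ws vs X i" for i
  define G where "G j l = partial_entry (loss k d n Ws vs \<nu> X) W j l" for j l
  have "(\<Sum>j<k. \<Sum>l<d. G j l * W j l) =
    (\<Sum>j<k. \<Sum>l<d. \<Sum>i<n. 2 * \<nu> / n * (r i * ip d (W j) (X i) * (W j l * X i l)))"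
    by (simp add: G_def partial_entry_loss r_def sum_distrib_left sum_distrib_right mult_ac)
  also have "\<dots> = (\<Sum>i<n. \<Sum>j<k. \<Sum>l<d. 2 * \<nu> / n * (r i * ip d (W j) (X i) * (W j l * X i l)))"
    by (simp only: sum.swap[of _ "{..<n}"])
  also have "\<dots> = 2 / n * (\<Sum>i<n. r i * net_out k d \<nu> X W i)"
    unfolding sum_distrib_left[symmetric] ip_def[of d "W _" "X _", symmetric]
    by (simp add: net_out_def sum_distrib_left power2_eq_square mult_ac)
  finally have eq: "(\<Sum>i<n. r i * net_out k d \<nu> X W i) = n / 2 * (\<Sum>j<k. \<Sum>l<d. G j l * W j l)"
    using assms(1) by simp
  have "(\<Sum>j<k. \<Sum>l<d. G j l * W j l) = (\<Sum>p\<in>{..<k}\<times>{..<d}. G (fst p) (snd p) * W (fst p) (snd p))"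
    by (simp add: sum.cartesian_product case_prod_beta)
  also have "\<dots> \<le> sqrt (\<Sum>p\<in>{..<k}\<times>{..<d}. (G (fst p) (snd p))\<^sup>2) * sqrt (\<Sum>p\<in>{..<k}\<times>{..<d}. (W (fst p) (snd p))\<^sup>2)"
    unfolding real_sqrt_mult[symmetric] by (rule real_le_rsqrt) (rule Cauchy_Schwarz_ineq_sum)
  also have "\<dots> = grad_frob k d (loss k d n Ws vs \<nu> X) W * sqrt (\<Sum>j<k. ip d (W j) (W j))"
    by (simp add: grad_frob_def G_def ip_def sum.cartesian_product case_prod_beta power2_eq_square)
  also have "\<dots> \<le> eps * sqrt (\<Sum>j<k. ip d (W j) (W j))"
    using assms(2) by (intro mult_right_mono) (auto intro!: sum_nonneg ip_self_nonneg)
  finally show ?thesis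
    unfolding r_def[symmetric] eq by (simp add: mult_left_mono mult.assoc)
qed

text \<open>Here \<open>f\<close>, \<open>g\<close>, \<open>N\<close> and \<open>s\<close> are \<open>sqrt \<nu>\<close> times the Frobenius norm of \<open>W\<close>, \<open>\<epsilon>g / sqrt \<nu>\<close>, the
  trace of \<open>W*\<^sup>T D W*\<close> and the root mean square of the network outputs.\<close>

lemma frob_bound_arith:
  fixes f g N s :: real
  assumes "0 \<le> f" "0 \<le> g" "0 \<le> N" "f\<^sup>2 / 10 \<le> s" "s\<^sup>2 \<le> g * f / 2 + sqrt 12 * N * s"
  shows "f \<le> 4 * max (sqrt (1 + 14 * N)) (4 * g)"
proof (rule ccontr)
  assume "\<not> ?thesis"
  then have f1: "4 * sqrt (1 + 14 * N) < f" and f2: "16 * g < f" by auto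
  have "(4 * sqrt (1 + 14 * N))\<^sup>2 < f\<^sup>2"
    using f1 assms by (intro power_strict_mono) auto
  then have fN: "16 * (1 + 14 * N) < f\<^sup>2" using assms by (simp add: power_mult_distrib)
  then have f16: "16 < f\<^sup>2" and Nf: "N < f\<^sup>2 / 224" using assms by auto
  have s: "0 < s" using assms(4) f16 by simp
  have "g * f \<le> f / 16 * f" using f2 assms by (intro mult_right_mono) auto
  then have 1: "g * f / 2 \<le> f\<^sup>2 / 32" by (simp add: power2_eq_square mult_ac)
  have "f\<^sup>2 * 16 \<le> f\<^sup>2 * f\<^sup>2" using f16 by (intro mult_left_mono) auto
  then have 2: "f\<^sup>2 / 32 \<le> (f\<^sup>2)\<^sup>2 / 512" by (simp add: power2_eq_square)
  have "(f\<^sup>2)\<^sup>2 \<le> (10 * s)\<^sup>2" using assms by (intro power_mono) auto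
  then have 3: "(f\<^sup>2)\<^sup>2 / 512 \<le> 100 / 512 * s\<^sup>2" by (simp add: power_mult_distrib)
  have "sqrt 12 \<le> 7 / 2" by (rule real_le_lsqrt) (auto simp: power2_eq_square)
  then have "sqrt 12 * N \<le> 7 / 2 * (f\<^sup>2 / 224)" using Nf assms by (intro mult_mono) auto
  also have "\<dots> \<le> 10 / 64 * s" using assms(4) by simp
  finally have "sqrt 12 * N * s \<le> 10 / 64 * s * s" using s by (intro mult_right_mono) auto
  then have "s\<^sup>2 \<le> 100 / 512 * s\<^sup>2 + 10 / 64 * s\<^sup>2"
    using 1 2 3 assms(5) unfolding power2_eq_square[of s] by linarith
  then show False using s by simp
qed

text \<open>The deterministic half of the argument: the samples enter only through
  \<open>cov\<close> and \<open>lab\<close>. The loss is split into residuals against outputs,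
  handled by the gradient, and residuals against labels, handled by the Hessian.\<close>

lemma approx_stationary_loss_bound:
  fixes k d n Ws vs \<nu> X W eg eH
  defines "N \<equiv> \<Sum>j<k. vs j * ip d (Ws j) (Ws j)"
  assumes "d < k" "0 < n" "0 < \<nu>" "0 \<le> eg" "0 \<le> eH" and vs: "\<And>j. j < k \<Longrightarrow> 0 \<le> vs j"
    and cov: "\<And>w. n / 10 * ip d w w \<le> (\<Sum>i<n. (ip d w (X i))\<^sup>2)"
    and lab: "(\<Sum>i<n. (label k d Ws vs X i)\<^sup>2) \<le> 12 * real n * N\<^sup>2"
    and grad: "grad_frob k d (loss k d n Ws vs \<nu> X) W \<le> eg"
    and hess: "hessian_ge k d (loss k d n Ws vs \<nu> X) W eH"
  shows "loss k d n Ws vs \<nu> X W \<le>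
    eg / sqrt \<nu> * max (sqrt (1 + 14 * N)) (4 * eg / sqrt \<nu>) + eH / (2 * \<nu>) * N"
proof -
  define q where "q = net_out k d \<nu> X W"
  define y where "y = label k d Ws vs X"
  define F where "F = sqrt (\<Sum>j<k. ip d (W j) (W j))"
  define s where "s = sqrt ((\<Sum>i<n. (q i)\<^sup>2) / n)"
  have F: "0 \<le> F" "F\<^sup>2 = (\<Sum>j<k. ip d (W j) (W j))"
    by (simp_all add: F_def sum_nonneg ip_self_nonneg)
  have s: "0 \<le> s" and Q: "(\<Sum>i<n. (q i)\<^sup>2) = n * s\<^sup>2"
    using \<open>0 < n\<close> by (simp_all add: s_def sum_nonneg)
  have N: "0 \<le> N"
    unfolding N_def using vs ip_self_nonneg by (intro sum_nonneg mult_nonneg_nonneg) auto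
  have rq: "(\<Sum>i<n. (q i - y i) * q i) \<le> n / 2 * eg * F"
    using frob_gradient_bound[OF \<open>0 < n\<close> grad] by (simp add: q_def y_def F_def)
  \<comment> \<open>A label is a nonnegative combination of squared projections onto the rows of
    \<open>Ws\<close>, so the Hessian inequality is used with b = \<open>Ws j\<close> and summed
    with weights \<open>vs j\<close>.\<close>
  have ry: "- (n * eH / (2 * \<nu>)) * N \<le> (\<Sum>i<n. (q i - y i) * y i)"
  proof -
    have "- (n * eH / (2 * \<nu>)) * N = (\<Sum>j<k. vs j * (- (n * eH / (2 * \<nu>)) * ip d (Ws j) (Ws j)))"
      by (simp add: N_def sum_distrib_left mult_ac)
    also have "\<dots> \<le> (\<Sum>j<k. vs j * (\<Sum>i<n. (q i - y i) * (ip d (Ws j) (X i))\<^sup>2))"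
      unfolding q_def y_def
      using hessian_ge_imp_residual_form_ge[OF \<open>d < k\<close> \<open>0 < n\<close> \<open>0 < \<nu>\<close> hess] vs
      by (intro sum_mono mult_left_mono) auto
    also have "\<dots> = (\<Sum>i<n. (q i - y i) * y i)"
    proof -
      have "(\<Sum>j<k. vs j * (z * (ip d (Ws j) (X i))\<^sup>2)) = z * y i" for z i
        by (simp add: y_def label_eq_ip sum_distrib_left mult_ac)
      then show ?thesis
        unfolding sum_distrib_left by (subst sum.swap) simp
    qed
    finally show ?thesis .
  qed
  have "(\<Sum>i<n. q i * y i) \<le> sqrt (\<Sum>i<n. (q i)\<^sup>2) * sqrt (\<Sum>i<n. (y i)\<^sup>2)"
    unfolding real_sqrt_mult[symmetric] by (rule real_le_rsqrt) (rule Cauchy_Schwarz_ineq_sum)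
  also have "\<dots> \<le> sqrt (n * s\<^sup>2) * sqrt (12 * real n * N\<^sup>2)"
    using lab Q by (intro mult_mono) (auto simp: y_def intro!: sum_nonneg)
  also have "\<dots> = n * (sqrt 12 * N * s)"
    using s N by (simp add: real_sqrt_mult)
  finally have qy: "(\<Sum>i<n. q i * y i) \<le> n * (sqrt 12 * N * s)" .
  have "n * s\<^sup>2 = (\<Sum>i<n. (q i - y i) * q i) + (\<Sum>i<n. q i * y i)"
    unfolding Q[symmetric] sum.distrib[symmetric] by (simp add: power2_eq_square algebra_simps)
  also have "\<dots> \<le> n * (eg * F / 2 + sqrt 12 * N * s)"
    using rq qy by (simp add: algebra_simps)
  finally have "s\<^sup>2 \<le> eg * F / 2 + sqrt 12 * N * s"
    using \<open>0 < n\<close> by simp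
  then have s2: "s\<^sup>2 \<le> (eg / sqrt \<nu>) * (sqrt \<nu> * F) / 2 + sqrt 12 * N * s"
    using \<open>0 < \<nu>\<close> by simp
  \<comment> \<open>The mean of the outputs is bounded below by \<open>cov\<close>, row by row, and
    above by their root mean square, through Cauchy-Schwarz against the constant 1.\<close>
  have "n * ((sqrt \<nu> * F)\<^sup>2 / 10) = \<nu> * (\<Sum>j<k. n / 10 * ip d (W j) (W j))"
    using \<open>0 < \<nu>\<close> F by (simp only: power_mult_distrib sum_distrib_left[symmetric]) simp
  also have "\<dots> \<le> \<nu> * (\<Sum>j<k. \<Sum>i<n. (ip d (W j) (X i))\<^sup>2)"
    using cov \<open>0 < \<nu>\<close> by (intro mult_left_mono sum_mono) auto
  also have "\<dots> = (\<Sum>i<n. q i * 1)"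
    by (subst sum.swap) (simp add: q_def net_out_def sum_distrib_left)
  also have "\<dots> \<le> sqrt ((\<Sum>i<n. (q i)\<^sup>2) * (\<Sum>i<n. 1\<^sup>2))"
    by (rule real_le_rsqrt) (rule Cauchy_Schwarz_ineq_sum)
  also have "\<dots> = n * s"
    using s by (simp add: Q real_sqrt_mult)
  finally have "(sqrt \<nu> * F)\<^sup>2 / 10 \<le> s"
    using \<open>0 < n\<close> by simp
  then have "sqrt \<nu> * F \<le> 4 * max (sqrt (1 + 14 * N)) (4 * (eg / sqrt \<nu>))"
    by (intro frob_bound_arith[OF _ _ N _ s2]) (use F \<open>0 < \<nu>\<close> \<open>0 \<le> eg\<close> in auto)
  then have "eg / sqrt \<nu> * (sqrt \<nu> * F) \<le> eg / sqrt \<nu> * (4 * max (sqrt (1 + 14 * N)) (4 * (eg / sqrt \<nu>)))"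
    using \<open>0 < \<nu>\<close> \<open>0 \<le> eg\<close> by (intro mult_left_mono) auto
  \<comment> \<open>The factor 4 from \<open>frob_bound_arith\<close> is paid for by the 1/4 that
    arises as 1 / (2 n) times n / 2 in the loss.\<close>
  then have egF: "eg * F / 4 \<le> eg / sqrt \<nu> * max (sqrt (1 + 14 * N)) (4 * eg / sqrt \<nu>)"
    using \<open>0 < \<nu>\<close> by (simp add: mult_ac)
  have "loss k d n Ws vs \<nu> X W = 1 / (2 * n) * ((\<Sum>i<n. (q i - y i) * q i) - (\<Sum>i<n. (q i - y i) * y i))"
    unfolding loss_eq_net_out q_def[symmetric] y_def[symmetric] sum_subtractf[symmetric]
    by (simp add: power2_eq_square algebra_simps)
  also have "\<dots> \<le> 1 / (2 * n) * (n / 2 * eg * F + (n * eH / (2 * \<nu>)) * N)"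
    using rq ry by (intro mult_left_mono) auto
  also have "\<dots> = eg * F / 4 + eH / (2 * \<nu>) * N / 2"
    using \<open>0 < n\<close> by (simp add: field_simps)
  also have "\<dots> \<le> eg * F / 4 + eH / (2 * \<nu>) * N"
  proof -
    have "0 \<le> eH / (2 * \<nu>) * N" using N \<open>0 \<le> eH\<close> \<open>0 < \<nu>\<close> by simp
    moreover have "x / 2 \<le> x" if "0 \<le> x" for x :: real using that by simp
    ultimately show ?thesis by (intro add_left_mono) blast
  qed
  also have "\<dots> \<le> eg / sqrt \<nu> * max (sqrt (1 + 14 * N)) (4 * eg / sqrt \<nu>) + eH / (2 * \<nu>) * N"
    using egF by (rule add_right_mono)
  finally show ?thesis .
qed

section \<open>Sums of independent samples\<close>

text \<open>The joint law of the coordinates is the product measure itself, hence the product of the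
  marginals; restriction to \<open>I\<close> is the identity on the extensional functions of the
  space.\<close>

lemma (in prob_space) indep_vars_PiM_coordinates:
  assumes "I \<noteq> {}"
  shows "prob_space.indep_vars (PiM I (\<lambda>_. M)) (\<lambda>_. M) (\<lambda>i \<omega>. \<omega> i) I"
proof -
  interpret P: prob_space "PiM I (\<lambda>_. M)"
    by (rule prob_space_PiM) (rule prob_space_axioms)
  have "distr (PiM I (\<lambda>_. M)) (PiM I (\<lambda>_. M)) (\<lambda>x. restrict x I) = distr (PiM I (\<lambda>_. M)) (PiM I (\<lambda>_. M)) (\<lambda>x. x)"
    by (rule distr_cong) (auto simp: space_PiM PiE_def extensional_restrict)
  also have "\<dots> = PiM I (\<lambda>i. distr (PiM I (\<lambda>_. M)) M (\<lambda>\<omega>. \<omega> i))"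
    unfolding distr_id
    by (rule PiM_cong) (simp_all add: distr_PiM_component[OF prob_space_axioms])
  finally show ?thesis
    using assms by (subst P.indep_vars_iff_distr_eq_PiM') auto
qed

lemma (in prob_space) has_bochner_integral_PiM_coordinate:
  fixes f :: "'a \<Rightarrow> real"
  assumes "i \<in> I" "has_bochner_integral M f x"
  shows "has_bochner_integral (PiM I (\<lambda>_. M)) (\<lambda>\<omega>. f (\<omega> i)) x"
proof -
  have "distr (PiM I (\<lambda>_. M)) M (\<lambda>\<omega>. \<omega> i) = M"
    by (rule distr_PiM_component[OF prob_space_axioms \<open>i \<in> I\<close>])
  then have "has_bochner_integral (distr (PiM I (\<lambda>_. M)) M (\<lambda>\<omega>. \<omega> i)) f x"
    using assms(2) by simp
  moreover have "(\<lambda>\<omega>. \<omega> i) \<in> measurable (PiM I (\<lambda>_. M)) M" "f \<in> borel_measurable M"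
    using assms by (auto dest: has_bochner_integral_integrable)
  ultimately show ?thesis
    by (auto simp: has_bochner_integral_iff integrable_distr_eq integral_distr)
qed

text \<open>After expanding the square, independence and zero mean remove every off-diagonal
  term.\<close>

lemma (in prob_space) iid_centered_sum_square:
  fixes g :: "'a \<Rightarrow> real"
  assumes "finite I" and [measurable]: "g \<in> borel_measurable M"
    and sq: "integrable M (\<lambda>x. (g x)\<^sup>2)" and mean: "expectation g = 0"
  shows "has_bochner_integral (PiM I (\<lambda>_. M)) (\<lambda>\<omega>. (\<Sum>i\<in>I. g (\<omega> i))\<^sup>2)
    (card I * expectation (\<lambda>x. (g x)\<^sup>2))"
proof (cases "I = {}")
  case False
  interpret P: prob_space "PiM I (\<lambda>_. M)"
    by (rule prob_space_PiM) (rule prob_space_axioms)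
  have g: "has_bochner_integral M g 0"
    using square_integrable_imp_integrable[OF _ sq] mean by (simp add: has_bochner_integral_iff)
  have indep: "P.indep_vars (\<lambda>_. borel) (\<lambda>i \<omega>. g (\<omega> i)) I"
    by (rule P.indep_vars_compose2[OF indep_vars_PiM_coordinates[OF False]]) simp
  have cross: "has_bochner_integral (PiM I (\<lambda>_. M)) (\<lambda>\<omega>. g (\<omega> i) * g (\<omega> j))
      (if j = i then expectation (\<lambda>x. (g x)\<^sup>2) else 0)" if "i \<in> I" "j \<in> I" for i j
  proof (cases "i = j")
    case True
    then show ?thesis
      using has_bochner_integral_PiM_coordinate[OF \<open>i \<in> I\<close>, of "\<lambda>x. (g x)\<^sup>2"] sq
      by (simp add: has_bochner_integral_iff power2_eq_square)
  next
    case ij: False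
    have "P.indep_vars (\<lambda>_. borel) (\<lambda>i \<omega>. g (\<omega> i)) {i, j}"
      by (rule P.indep_vars_subset[OF indep]) (use that in auto)
    moreover have "integrable (PiM I (\<lambda>_. M)) (\<lambda>\<omega>. g (\<omega> l))"
      "P.expectation (\<lambda>\<omega>. g (\<omega> l)) = 0" if "l \<in> {i, j}" for l
      using has_bochner_integral_PiM_coordinate[of l I g 0] g that \<open>i \<in> I\<close> \<open>j \<in> I\<close>
      by (auto simp: has_bochner_integral_iff)
    ultimately have "has_bochner_integral (PiM I (\<lambda>_. M)) (\<lambda>\<omega>. \<Prod>l\<in>{i, j}. g (\<omega> l)) 0"
      using P.indep_vars_lebesgue_integral[of "{i, j}" "\<lambda>i \<omega>. g (\<omega> i)"]
        P.indep_vars_integrable[of "{i, j}" "\<lambda>i \<omega>. g (\<omega> i)"]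
      by (simp add: has_bochner_integral_iff card_gt_0_iff)
    then show ?thesis using ij by simp
  qed
  have "has_bochner_integral (PiM I (\<lambda>_. M)) (\<lambda>\<omega>. \<Sum>i\<in>I. \<Sum>j\<in>I. g (\<omega> i) * g (\<omega> j))
    (\<Sum>i\<in>I. \<Sum>j\<in>I. if j = i then expectation (\<lambda>x. (g x)\<^sup>2) else 0)"
    by (intro has_bochner_integral_sum cross)
  then show ?thesis
    using \<open>finite I\<close> by (simp add: power2_eq_square sum_product)
qed (simp add: has_bochner_integral_zero)

text \<open>Chebyshev's inequality for the centred sum, with the variance estimated by the second
  moment. Mean and second moment enter only through upper bounds, so they need not be computed
  exactly.\<close>

lemma (in prob_space) iid_sum_upper_tail:
  fixes f :: "'a \<Rightarrow> real" and n :: nat and \<mu> t B :: real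
  assumes "0 < n" "0 < t" and [measurable]: "f \<in> borel_measurable M"
    and sq: "integrable M (\<lambda>x. (f x)\<^sup>2)" and B: "expectation (\<lambda>x. (f x)\<^sup>2) \<le> B"
    and mean: "expectation f \<le> \<mu>"
  shows "measure (PiM {..<n} (\<lambda>_. M))
    {\<omega> \<in> space (PiM {..<n} (\<lambda>_. M)). n * (\<mu> + t) \<le> (\<Sum>i<n. f (\<omega> i))} \<le> B / (n * t\<^sup>2)"
proof -
  let ?P = "PiM {..<n} (\<lambda>_. M)"
  interpret P: prob_space ?P
    by (rule prob_space_PiM) (rule prob_space_axioms)
  define g where "g x = f x - expectation f" for x
  have f: "integrable M f" using square_integrable_imp_integrable[OF _ sq] by simp
  have [measurable]: "g \<in> borel_measurable M" unfolding g_def by simp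
  have g2: "integrable M (\<lambda>x. (g x)\<^sup>2)"
    using f sq by (simp add: g_def power2_diff)
  have g0: "expectation g = 0"
    using f by (simp add: g_def[abs_def] prob_space)
  have "expectation (\<lambda>x. (g x)\<^sup>2) \<le> B"
    using variance_eq[OF f sq] B unfolding g_def by (smt (verit) zero_le_power2)
  have sum2: "has_bochner_integral ?P (\<lambda>\<omega>. (\<Sum>i<n. g (\<omega> i))\<^sup>2) (n * expectation (\<lambda>x. (g x)\<^sup>2))"
    using iid_centered_sum_square[OF _ _ g2 g0, of "{..<n}"] by simp
  have "measure ?P {\<omega> \<in> space ?P. n * (\<mu> + t) \<le> (\<Sum>i<n. f (\<omega> i))} \<le>
    measure ?P {\<omega> \<in> space ?P. n * t \<le> \<bar>\<Sum>i<n. g (\<omega> i)\<bar>}"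
  proof (rule P.finite_measure_mono)
    show "{\<omega> \<in> space ?P. n * (\<mu> + t) \<le> (\<Sum>i<n. f (\<omega> i))} \<subseteq> {\<omega> \<in> space ?P. n * t \<le> \<bar>\<Sum>i<n. g (\<omega> i)\<bar>}"
    proof safe
      fix \<omega> assume "n * (\<mu> + t) \<le> (\<Sum>i<n. f (\<omega> i))"
      moreover have "n * expectation f \<le> n * \<mu>" using mean by (intro mult_left_mono) auto
      moreover have "(\<Sum>i<n. g (\<omega> i)) = (\<Sum>i<n. f (\<omega> i)) - n * expectation f"
        by (simp add: g_def sum_subtractf)
      ultimately show "n * t \<le> \<bar>\<Sum>i<n. g (\<omega> i)\<bar>" by (simp add: distrib_left)
    qed
  qed measurable
  also have "\<dots> \<le> (\<integral>\<omega>. (\<Sum>i<n. g (\<omega> i))\<^sup>2 \<partial>?P) / (n * t)\<^sup>2"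
    using sum2 \<open>0 < n\<close> \<open>0 < t\<close>
    by (intro P.second_moment_method) (auto simp: has_bochner_integral_iff)
  also have "\<dots> = n * expectation (\<lambda>x. (g x)\<^sup>2) / (n * t)\<^sup>2"
    using sum2 by (simp add: has_bochner_integral_iff)
  also have "\<dots> = expectation (\<lambda>x. (g x)\<^sup>2) / (n * t\<^sup>2)"
    using \<open>0 < n\<close> by (simp add: power2_eq_square)
  also have "\<dots> \<le> B / (n * t\<^sup>2)"
    using \<open>expectation (\<lambda>x. (g x)\<^sup>2) \<le> B\<close> by (intro divide_right_mono) auto
  finally show ?thesis .
qed

text \<open>The Chernoff method: Markov's inequality for the product of the exp (a - f), whose
  expectation factorises.\<close>

lemma (in prob_space) iid_sum_lower_tail:
  fixes f :: "'a \<Rightarrow> real"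
  assumes int: "integrable M (\<lambda>x. exp (- f x))" and [measurable]: "f \<in> borel_measurable M"
  shows "measure (PiM {..<n} (\<lambda>_. M))
    {\<omega> \<in> space (PiM {..<n} (\<lambda>_. M)). (\<Sum>i<n. f (\<omega> i)) \<le> n * a} \<le> (exp a * expectation (\<lambda>x. exp (- f x))) ^ n"
proof -
  let ?P = "PiM {..<n} (\<lambda>_. M)"
  interpret P: product_prob_space "\<lambda>_::nat. M" "{..<n}"
    by (rule product_prob_spaceI) (rule prob_space_axioms)
  let ?u = "\<lambda>\<omega>. \<Prod>i<n. exp a * exp (- f (\<omega> i))"
  have int': "integrable M (\<lambda>x. exp a * exp (- f x))" using int by simp
  have u: "integrable ?P ?u"
    by (rule P.product_integrable_prod) (use int' in auto)
  have "{\<omega> \<in> space ?P. (\<Sum>i<n. f (\<omega> i)) \<le> n * a} = {\<omega> \<in> space ?P. 1 \<le> ?u \<omega>}"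
    by (auto simp: exp_sum[symmetric] exp_add[symmetric] sum_subtractf)
  then have "measure ?P {\<omega> \<in> space ?P. (\<Sum>i<n. f (\<omega> i)) \<le> n * a} = measure ?P {\<omega> \<in> space ?P. 1 \<le> ?u \<omega>}"
    by simp
  also have "\<dots> \<le> (\<integral>\<omega>. ?u \<omega> \<partial>?P) / 1"
    by (rule integral_Markov_inequality_measure[OF u, of "{}"]) (auto intro!: prod_nonneg)
  also have "(\<integral>\<omega>. ?u \<omega> \<partial>?P) = (\<Prod>i<n. expectation (\<lambda>x. exp a * exp (- f x)))"
    by (rule P.product_integral_prod) (use int' in auto)
  finally show ?thesis by simp
qed

section \<open>Standard Gaussian vectors and their one-dimensional projections\<close>

abbreviation gauss_vec :: "nat \<Rightarrow> (nat \<Rightarrow> real) measure" where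
  "gauss_vec d \<equiv> PiM {..<d} (\<lambda>_. std_gauss)"

lemma prob_space_std_gauss: "prob_space std_gauss"
  unfolding std_gauss_def by (rule prob_space_normal_density) simp

lemma sets_std_gauss[measurable_cong, simp]: "sets std_gauss = sets borel"
  by (simp add: std_gauss_def)

lemma prob_space_gauss_vec: "prob_space (gauss_vec d)"
  by (rule prob_space_PiM) (rule prob_space_std_gauss)

lemma measurable_ip[measurable]: "ip d w \<in> borel_measurable (gauss_vec d)"
  unfolding ip_def by measurable

lemma distributed_ip_gauss_vec:
  assumes "ip d w w \<noteq> 0"
  shows "distributed (gauss_vec d) lborel (ip d w) (normal_density 0 (sqrt (ip d w w)))"
proof -
  interpret P: prob_space "gauss_vec d" by (rule prob_space_gauss_vec)
  \<comment> \<open>A zero weight would give a degenerate normal variable of standard deviation 0,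
    so such coordinates are dropped before summing independent normals.\<close>
  define I where "I = {l\<in>{..<d}. w l \<noteq> 0}"
  have sum_I: "(\<Sum>l\<in>I. w l * x l) = ip d w x" for x
    unfolding ip_def I_def by (rule sum.mono_neutral_left) auto
  have "I \<noteq> {}"
  proof
    assume "I = {}"
    then show False using assms sum_I[of w] by simp
  qed
  then have I: "finite I" "I \<noteq> {}" "I \<subseteq> {..<d}"
    by (auto simp: I_def)
  then have "{..<d} \<noteq> {}" by auto
  have coord: "distributed (gauss_vec d) lborel (\<lambda>x. x l) std_normal_density" if "l < d" for l
    using distr_PiM_component[of "{..<d}" "\<lambda>_. std_gauss" l] prob_space_std_gauss that
      distr_cong[of "gauss_vec d" "gauss_vec d" lborel std_gauss "\<lambda>x. x l" "\<lambda>x. x l"]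
    by (auto simp: distributed_def std_gauss_def[symmetric])
  have scaled: "distributed (gauss_vec d) lborel (\<lambda>x. w l * x l) (normal_density 0 \<bar>w l\<bar>)" if "l \<in> I" for l
    using P.normal_density_affine[OF coord[of l], of "w l" 0] that by (auto simp: I_def)
  have "P.indep_vars (\<lambda>_. borel) (\<lambda>l x. w l * x l) {..<d}"
    by (rule P.indep_vars_compose2[OF prob_space.indep_vars_PiM_coordinates[OF prob_space_std_gauss \<open>{..<d} \<noteq> {}\<close>]])
       simp
  then have "P.indep_vars (\<lambda>_. borel) (\<lambda>l x. w l * x l) I"
    by (rule P.indep_vars_subset) (rule I(3))
  from P.sum_indep_normal[OF I(1,2) this _ scaled]
  have "distributed (gauss_vec d) lborel (\<lambda>x. \<Sum>l\<in>I. w l * x l) (normal_density 0 (sqrt (\<Sum>l\<in>I. (w l)\<^sup>2)))"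
    by (simp add: I_def)
  then show ?thesis
    using sum_I[of w] by (simp add: sum_I power2_eq_square)
qed

text \<open>The projection is normal with variance \<open>ip d w w\<close>, so this is the classical
  normal moment. A vector of norm 0 is covered too: both sides are then 1 for k = 0 and 0
  otherwise.\<close>

lemma ip_gauss_vec_even_moment:
  "has_bochner_integral (gauss_vec d) (\<lambda>x. (ip d w x) ^ (2 * k))
    (fact (2 * k) / (2 ^ k * fact k) * (ip d w w) ^ k)"
proof (cases "ip d w w = 0")
  case True
  interpret P: prob_space "gauss_vec d" by (rule prob_space_gauss_vec)
  have "ip d w x = 0" for x
    using ip_self_eq_0[OF True] by (simp add: ip_def)
  then show ?thesis
    using True P.prob_space by (cases k) (auto simp: has_bochner_integral_iff)
next
  case False
  then have pos: "0 < ip d w w" using ip_self_nonneg[of d w] by simp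
  let ?\<sigma> = "sqrt (ip d w w)"
  have "0 < ?\<sigma>" using pos by simp
  from normal_moment_even[OF this, of 0 k]
  have "has_bochner_integral lborel (\<lambda>x. normal_density 0 ?\<sigma> x * x ^ (2 * k))
    (fact (2 * k) / (2 ^ k * fact k) * (ip d w w) ^ k)"
    using pos by (simp add: power_divide)
  then show ?thesis
    using distributed_integral[OF distributed_ip_gauss_vec[OF False], of "\<lambda>x. x ^ (2 * k)"]
      distributed_integrable[OF distributed_ip_gauss_vec[OF False], of "\<lambda>x. x ^ (2 * k)"]
    by (simp add: has_bochner_integral_iff)
qed

text \<open>With the factor 3/2 the exponent of the density is multiplied by 1 + 3 = 4, so the
  integrand is half of a normal density with half the standard deviation.\<close>

lemma ip_gauss_vec_laplace:
  assumes "ip d w w \<noteq> 0"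
  shows "has_bochner_integral (gauss_vec d) (\<lambda>x. exp (- (3 / 2 * (ip d w x)\<^sup>2 / ip d w w))) (1 / 2)"
proof -
  have pos: "0 < ip d w w" using assms ip_self_nonneg[of d w] by simp
  let ?\<sigma> = "sqrt (ip d w w)"
  have dens: "normal_density 0 ?\<sigma> x * exp (- (3 / 2 * x\<^sup>2 / ip d w w)) = 1 / 2 * normal_density 0 (?\<sigma> / 2) x" for x
  proof -
    have "- (x\<^sup>2) / (2 * ip d w w) - 3 / 2 * x\<^sup>2 / ip d w w = - (x\<^sup>2) / (2 * (ip d w w / 4))"
      using pos by (simp add: field_simps)
    moreover have "sqrt (2 * pi * (ip d w w / 4)) = sqrt (2 * pi * ip d w w) / 2"
      unfolding times_divide_eq_right real_sqrt_divide real_sqrt_four ..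
    then have "2 * sqrt (pi * ip d w w / 2) = sqrt (2 * pi * ip d w w)"
      by simp
    ultimately show ?thesis
      using pos by (simp add: normal_density_def power_divide mult_exp_exp mult.commute[of "x\<^sup>2"])
  qed
  have "has_bochner_integral lborel (\<lambda>x. 1 / 2 * normal_density 0 (?\<sigma> / 2) x) (1 / 2 * 1)"
    using pos by (intro has_bochner_integral_mult_right) (simp add: has_bochner_integral_iff)
  then have "has_bochner_integral lborel (\<lambda>x. normal_density 0 ?\<sigma> x * exp (- (3 / 2 * x\<^sup>2 / ip d w w))) (1 / 2)"
    by (simp only: dens mult_1_right)
  then show ?thesis
    using distributed_integral[OF distributed_ip_gauss_vec[OF assms], of "\<lambda>x. exp (- (3 / 2 * x\<^sup>2 / ip d w w))"]
      distributed_integrable[OF distributed_ip_gauss_vec[OF assms], of "\<lambda>x. exp (- (3 / 2 * x\<^sup>2 / ip d w w))"]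
    by (simp add: has_bochner_integral_iff)
qed

section \<open>Tail bounds for Gaussian samples\<close>

lemma prob_space_gauss_samples: "prob_space (gauss_samples n d)"
  unfolding gauss_samples_def by (rule prob_space_PiM) (rule prob_space_gauss_vec)

lemma measurable_ip_gauss_samples[measurable]:
  "i < n \<Longrightarrow> (\<lambda>X. ip d w (X i)) \<in> borel_measurable (gauss_samples n d)"
  unfolding gauss_samples_def by measurable

lemma ip_unit_vector: "l < d \<Longrightarrow> ip d (\<lambda>a. if a = l then 1 else 0) x = x l"
  by (simp add: ip_def if_distrib[of "\<lambda>a. a * _"] cong: if_cong)

lemma measurable_sample_norm[measurable]:
  "i < n \<Longrightarrow> (\<lambda>X. ip d (X i) (X i)) \<in> borel_measurable (gauss_samples n d)"
proof -
  assume "i < n"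
  define e :: "nat \<Rightarrow> nat \<Rightarrow> real" where "e l = (\<lambda>a. if a = l then 1 else 0)" for l
  have "ip d x x = (\<Sum>l<d. ip d (e l) x * ip d (e l) x)" for x
    by (simp only: e_def ip_def[of d x x]) (simp add: ip_unit_vector)
  moreover have "(\<lambda>X. \<Sum>l<d. ip d (e l) (X i) * ip d (e l) (X i)) \<in> borel_measurable (gauss_samples n d)"
    using \<open>i < n\<close>
    by (intro borel_measurable_sum borel_measurable_times measurable_ip_gauss_samples)
  ultimately show ?thesis by (simp only:)
qed

lemma sample_norm_tail:
  assumes "0 < n" "0 < d"
  shows "measure (gauss_samples n d)
    {X \<in> space (gauss_samples n d). n * (real d)\<^sup>2 \<le> (\<Sum>i<n. ip d (X i) (X i))} \<le> 1 / d"
proof -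
  have "has_bochner_integral (gauss_vec d) (\<lambda>x. (x l)\<^sup>2) 1" if "l < d" for l
    using ip_gauss_vec_even_moment[of d "\<lambda>a. if a = l then 1 else 0" 1]
    unfolding ip_unit_vector[OF that] by simp
  then have "has_bochner_integral (gauss_vec d) (\<lambda>x. \<Sum>l<d. (x l)\<^sup>2) (\<Sum>l<d. 1)"
    by (intro has_bochner_integral_sum) auto
  then have vec: "has_bochner_integral (gauss_vec d) (\<lambda>x. ip d x x) d"
    by (simp add: ip_def power2_eq_square)
  have "has_bochner_integral (gauss_samples n d) (\<lambda>X. ip d (X i) (X i)) d" if "i < n" for i
    unfolding gauss_samples_def
    by (rule prob_space.has_bochner_integral_PiM_coordinate[OF prob_space_gauss_vec _ vec])
      (simp add: that)
  then have "has_bochner_integral (gauss_samples n d) (\<lambda>X. \<Sum>i<n. ip d (X i) (X i)) (\<Sum>i<n. real d)"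
    by (intro has_bochner_integral_sum) simp
  then have int: "has_bochner_integral (gauss_samples n d) (\<lambda>X. \<Sum>i<n. ip d (X i) (X i)) (n * d)"
    by simp
  have "measure (gauss_samples n d)
    {X \<in> space (gauss_samples n d). n * (real d)\<^sup>2 \<le> (\<Sum>i<n. ip d (X i) (X i))} \<le>
    (\<integral>X. (\<Sum>i<n. ip d (X i) (X i)) \<partial>gauss_samples n d) / (n * (real d)\<^sup>2)"
  proof (rule integral_Markov_inequality_measure)
    show "integrable (gauss_samples n d) (\<lambda>X. \<Sum>i<n. ip d (X i) (X i))"
      using int by (simp only: has_bochner_integral_iff)
    show "{} \<in> sets (gauss_samples n d)" by simp
    show "AE X in gauss_samples n d. 0 \<le> (\<Sum>i<n. ip d (X i) (X i))"
      by (intro AE_I2 sum_nonneg ip_self_nonneg)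
    show "0 < n * (real d)\<^sup>2" using assms by simp
  qed
  also have "\<dots> = 1 / d"
    unfolding has_bochner_integral_integral_eq[OF int] using assms by (simp add: power2_eq_square)
  finally show ?thesis .
qed

lemma ip_eq_0_of_self_eq_0: "ip d w w = 0 \<Longrightarrow> ip d w x = 0"
  unfolding ip_def[of d w x] using ip_self_eq_0[of d w] by (intro sum.neutral) auto

text \<open>Jensen's inequality for the weights \<open>vs j * ip d (Ws j) (Ws j)\<close>; terms with \<open>Ws j = 0\<close> vanish
  on both sides since \<open>0 / 0 = 0\<close>.\<close>

lemma label_power4_le:
  fixes k d :: nat and Ws :: "nat \<Rightarrow> nat \<Rightarrow> real" and vs :: "nat \<Rightarrow> real"
  defines "N \<equiv> \<Sum>j<k. vs j * ip d (Ws j) (Ws j)"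
  assumes vs: "\<And>j. j < k \<Longrightarrow> 0 \<le> vs j"
  shows "(\<Sum>j<k. vs j * (ip d (Ws j) x)\<^sup>2) ^ 4 \<le>
    N ^ 3 * (\<Sum>j<k. vs j * ip d (Ws j) (Ws j) * ((ip d (Ws j) x) ^ 8 / (ip d (Ws j) (Ws j)) ^ 4))"
proof -
  define p where "p j = vs j * ip d (Ws j) (Ws j)" for j
  define h where "h j = (ip d (Ws j) x)\<^sup>2 / ip d (Ws j) (Ws j)" for j
  have p: "0 \<le> p j" if "j < k" for j
    using vs[OF that] ip_self_nonneg by (simp add: p_def)
  have N: "N = (\<Sum>j<k. p j)" by (simp add: N_def p_def)
  have N0: "0 \<le> N" unfolding N using p by (intro sum_nonneg) auto
  \<comment> \<open>Jensen's inequality for squaring, from Cauchy-Schwarz with weights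
    \<open>p j\<close>. Using it for \<open>h\<close> and then for the square of \<open>h\<close>
    yields the fourth power.\<close>
  have sq: "(\<Sum>j<k. p j * g j)\<^sup>2 \<le> N * (\<Sum>j<k. p j * (g j)\<^sup>2)" for g
  proof -
    have "(\<Sum>j<k. p j * g j) = (\<Sum>j<k. sqrt (p j) * (sqrt (p j) * g j))"
      using p by (intro sum.cong) (auto simp: mult.assoc[symmetric])
    then have "(\<Sum>j<k. p j * g j)\<^sup>2 \<le> (\<Sum>j<k. (sqrt (p j))\<^sup>2) * (\<Sum>j<k. (sqrt (p j) * g j)\<^sup>2)"
      using Cauchy_Schwarz_ineq_sum[of "\<lambda>j. sqrt (p j)" "\<lambda>j. sqrt (p j) * g j"] by simp
    also have "\<dots> = N * (\<Sum>j<k. p j * (g j)\<^sup>2)"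
      using p by (simp add: N power_mult_distrib)
    finally show ?thesis .
  qed
  have "(\<Sum>j<k. vs j * (ip d (Ws j) x)\<^sup>2) = (\<Sum>j<k. p j * h j)"
  proof (intro sum.cong refl)
    fix j
    show "vs j * (ip d (Ws j) x)\<^sup>2 = p j * h j"
      by (cases "ip d (Ws j) (Ws j) = 0") (simp_all add: p_def h_def ip_eq_0_of_self_eq_0[of d "Ws j" x])
  qed
  then have "(\<Sum>j<k. vs j * (ip d (Ws j) x)\<^sup>2) ^ 4 = ((\<Sum>j<k. p j * h j)\<^sup>2)\<^sup>2"
    by (simp only: power_mult[symmetric]) simp
  also have "\<dots> \<le> (N * (\<Sum>j<k. p j * (h j)\<^sup>2))\<^sup>2"
    by (intro power_mono sq) auto
  also have "\<dots> = N\<^sup>2 * (\<Sum>j<k. p j * (h j)\<^sup>2)\<^sup>2"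
    by (rule power_mult_distrib)
  also have "\<dots> \<le> N\<^sup>2 * (N * (\<Sum>j<k. p j * ((h j)\<^sup>2)\<^sup>2))"
    by (intro mult_left_mono sq) auto
  also have "\<dots> = N ^ 3 * (\<Sum>j<k. p j * ((ip d (Ws j) x) ^ 8 / (ip d (Ws j) (Ws j)) ^ 4))"
  proof -
    have "((h j)\<^sup>2)\<^sup>2 = (ip d (Ws j) x) ^ 8 / (ip d (Ws j) (Ws j)) ^ 4" for j
      unfolding h_def power_divide power_mult[symmetric] by simp
    then show ?thesis by (simp only: power2_eq_square[of N] power3_eq_cube mult.assoc)
  qed
  finally show ?thesis by (simp only: p_def)
qed

text \<open>\<open>label_power4_le\<close> reduces the claim to eighth moments of normal variables,
  and 105 = 7 * 5 * 3 * 1 is that of the standard normal.\<close>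

lemma label_vec_fourth_moment:
  fixes k d :: nat and Ws :: "nat \<Rightarrow> nat \<Rightarrow> real" and vs :: "nat \<Rightarrow> real"
  defines "N \<equiv> \<Sum>j<k. vs j * ip d (Ws j) (Ws j)"
  assumes vs: "\<And>j. j < k \<Longrightarrow> 0 \<le> vs j"
  shows "integrable (gauss_vec d) (\<lambda>x. (\<Sum>j<k. vs j * (ip d (Ws j) x)\<^sup>2) ^ 4)"
    and "(\<integral>x. (\<Sum>j<k. vs j * (ip d (Ws j) x)\<^sup>2) ^ 4 \<partial>gauss_vec d) \<le> 105 * N ^ 4"
proof -
  have nn: "0 \<le> vs j * ip d (Ws j) (Ws j)" if "j < k" for j
    using vs[OF that] ip_self_nonneg by simp
  have N: "0 \<le> N" unfolding N_def using nn by (intro sum_nonneg) auto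
  have "has_bochner_integral (gauss_vec d) (\<lambda>x. (ip d (Ws j) x) ^ 8) (105 * ip d (Ws j) (Ws j) ^ 4)" for j
    using ip_gauss_vec_even_moment[of d "Ws j" 4] by (simp add: fact_numeral)
  then have bound: "has_bochner_integral (gauss_vec d)
    (\<lambda>x. N ^ 3 * (\<Sum>j<k. vs j * ip d (Ws j) (Ws j) * ((ip d (Ws j) x) ^ 8 / (ip d (Ws j) (Ws j)) ^ 4)))
    (N ^ 3 * (\<Sum>j<k. vs j * ip d (Ws j) (Ws j) * (105 * ip d (Ws j) (Ws j) ^ 4 / (ip d (Ws j) (Ws j)) ^ 4)))"
    by (intro has_bochner_integral_mult_right has_bochner_integral_sum has_bochner_integral_divide) auto
  then have bound_int: "integrable (gauss_vec d) (\<lambda>x. N ^ 3 * (\<Sum>j<k. vs j * ip d (Ws j) (Ws j) *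
        ((ip d (Ws j) x) ^ 8 / (ip d (Ws j) (Ws j)) ^ 4)))"
    by (simp only: has_bochner_integral_iff)
  have norm_le: "norm a \<le> norm b" if "0 \<le> a" "a \<le> b" for a b :: real
    using that by simp
  show int: "integrable (gauss_vec d) (\<lambda>x. (\<Sum>j<k. vs j * (ip d (Ws j) x)\<^sup>2) ^ 4)"
  proof (rule Bochner_Integration.integrable_bound)
    show "integrable (gauss_vec d) (\<lambda>x. N ^ 3 * (\<Sum>j<k. vs j * ip d (Ws j) (Ws j) *
        ((ip d (Ws j) x) ^ 8 / (ip d (Ws j) (Ws j)) ^ 4)))"
      by (rule bound_int)
    show "AE x in gauss_vec d. norm ((\<Sum>j<k. vs j * (ip d (Ws j) x)\<^sup>2) ^ 4) \<le>
      norm (N ^ 3 * (\<Sum>j<k. vs j * ip d (Ws j) (Ws j) * ((ip d (Ws j) x) ^ 8 / (ip d (Ws j) (Ws j)) ^ 4)))"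
      by (intro AE_I2 norm_le) (simp, rule label_power4_le[of k vs d Ws, OF vs, folded N_def])
  qed measurable
  have "(\<integral>x. (\<Sum>j<k. vs j * (ip d (Ws j) x)\<^sup>2) ^ 4 \<partial>gauss_vec d) \<le>
    N ^ 3 * (\<Sum>j<k. vs j * ip d (Ws j) (Ws j) * (105 * ip d (Ws j) (Ws j) ^ 4 / (ip d (Ws j) (Ws j)) ^ 4))"
  proof -
    have "(\<integral>x. (\<Sum>j<k. vs j * (ip d (Ws j) x)\<^sup>2) ^ 4 \<partial>gauss_vec d) \<le>
      (\<integral>x. N ^ 3 * (\<Sum>j<k. vs j * ip d (Ws j) (Ws j) *
        ((ip d (Ws j) x) ^ 8 / (ip d (Ws j) (Ws j)) ^ 4)) \<partial>gauss_vec d)"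
      by (rule integral_mono[OF int bound_int])
        (rule label_power4_le[of k vs d Ws, OF vs, folded N_def])
    then show ?thesis using bound by (simp only: has_bochner_integral_iff)
  qed
  also have "\<dots> \<le> N ^ 3 * (\<Sum>j<k. vs j * ip d (Ws j) (Ws j) * 105)"
    using N nn by (intro mult_left_mono sum_mono) auto
  also have "\<dots> = 105 * N ^ 4"
    unfolding sum_distrib_right[symmetric] N_def[symmetric]
    by (simp add: power4_eq_xxxx power3_eq_cube)
  finally show "(\<integral>x. (\<Sum>j<k. vs j * (ip d (Ws j) x)\<^sup>2) ^ 4 \<partial>gauss_vec d) \<le> 105 * N ^ 4" .
qed

lemma measurable_label[measurable]:
  "i < n \<Longrightarrow> (\<lambda>X. label k d Ws vs X i) \<in> borel_measurable (gauss_samples n d)"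
  unfolding label_eq_ip by measurable

lemma label_tail:
  fixes k d :: nat and Ws :: "nat \<Rightarrow> nat \<Rightarrow> real" and vs :: "nat \<Rightarrow> real"
  defines "N \<equiv> \<Sum>j<k. vs j * ip d (Ws j) (Ws j)"
  assumes vs: "\<And>j. j < k \<Longrightarrow> 0 \<le> vs j" and "0 < n"
  shows "measure (gauss_samples n d)
    {X \<in> space (gauss_samples n d). 12 * real n * N\<^sup>2 < (\<Sum>i<n. (label k d Ws vs X i)\<^sup>2)} \<le> 35 / n"
proof (cases "N = 0")
  case True
  have "vs j * (ip d (Ws j) x)\<^sup>2 = 0" if "j < k" for j x
  proof -
    have "vs j * ip d (Ws j) (Ws j) = 0"
      using True vs ip_self_nonneg that unfolding N_def
      by (subst (asm) sum_nonneg_eq_0_iff) auto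
    then show ?thesis using ip_eq_0_of_self_eq_0[of d "Ws j" x] by auto
  qed
  then have "label k d Ws vs X i = 0" for X i
    unfolding label_eq_ip by (intro sum.neutral) auto
  then show ?thesis using True by simp
next
  case False
  interpret V: prob_space "gauss_vec d" by (rule prob_space_gauss_vec)
  interpret S: prob_space "gauss_samples n d" by (rule prob_space_gauss_samples)
  define f where "f x = (\<Sum>j<k. vs j * (ip d (Ws j) x)\<^sup>2)\<^sup>2" for x
  have [measurable]: "f \<in> borel_measurable (gauss_vec d)" unfolding f_def by measurable
  have f2: "(f x)\<^sup>2 = (\<Sum>j<k. vs j * (ip d (Ws j) x)\<^sup>2) ^ 4" for x
    by (simp add: f_def)
  have sq: "integrable (gauss_vec d) (\<lambda>x. (f x)\<^sup>2)"
    and B: "V.expectation (\<lambda>x. (f x)\<^sup>2) \<le> 105 * N ^ 4"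
    unfolding f2 N_def using label_vec_fourth_moment[of k vs d Ws, OF vs] by auto
  have f: "integrable (gauss_vec d) f" using V.square_integrable_imp_integrable[OF _ sq] by simp
  have "0 \<le> V.expectation (\<lambda>x. (f x)\<^sup>2) - (V.expectation f)\<^sup>2"
    unfolding V.variance_eq[OF f sq, symmetric] by (rule V.variance_positive)
  then have "(V.expectation f)\<^sup>2 \<le> 105 * N ^ 4" using B by simp
  also have "\<dots> \<le> (41 / 4 * N\<^sup>2)\<^sup>2"
    by (simp add: power_mult_distrib power_divide)
  finally have mean: "V.expectation f \<le> 41 / 4 * N\<^sup>2"
    by (rule power2_le_imp_le) simp
  have "measure (gauss_samples n d)
      {X \<in> space (gauss_samples n d). 12 * real n * N\<^sup>2 < (\<Sum>i<n. (label k d Ws vs X i)\<^sup>2)} \<le>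
    measure (gauss_samples n d)
      {X \<in> space (gauss_samples n d). n * (41 / 4 * N\<^sup>2 + 7 / 4 * N\<^sup>2) \<le> (\<Sum>i<n. (label k d Ws vs X i)\<^sup>2)}"
    by (rule S.finite_measure_mono) auto
  also have "\<dots> = measure (PiM {..<n} (\<lambda>_. gauss_vec d))
      {X \<in> space (PiM {..<n} (\<lambda>_. gauss_vec d)). n * (41 / 4 * N\<^sup>2 + 7 / 4 * N\<^sup>2) \<le> (\<Sum>i<n. f (X i))}"
    by (simp add: gauss_samples_def label_eq_ip f_def)
  also have "\<dots> \<le> 105 * N ^ 4 / (n * (7 / 4 * N\<^sup>2)\<^sup>2)"
    by (rule V.iid_sum_upper_tail[OF \<open>0 < n\<close> _ _ sq B mean]) (use False in auto)
  also have "\<dots> \<le> 35 / n"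
    using False \<open>0 < n\<close> by (simp add: power_mult_distrib power_divide field_simps)
  finally show ?thesis .
qed

section \<open>Lower bound on the sample covariance, uniform over directions\<close>

lemma covariance_direction_tail:
  assumes "ip d w w \<noteq> 0"
  shows "measure (gauss_samples n d)
    {X \<in> space (gauss_samples n d). (\<Sum>i<n. (ip d w (X i))\<^sup>2) \<le> n / 3 * ip d w w} \<le> (exp (1 / 2) / 2) ^ n"
proof -
  interpret V: prob_space "gauss_vec d" by (rule prob_space_gauss_vec)
  have pos: "0 < ip d w w" using assms ip_self_nonneg[of d w] by simp
  \<comment> \<open>Scaling by 3/2 turns the level n/3 into n/2 and matches
    \<open>ip_gauss_vec_laplace\<close>, so each sample contributes a factor exp (1/2) / 2 <
    1.\<close>
  have eq: "(\<Sum>i<n. (ip d w (X i))\<^sup>2) \<le> n / 3 * ip d w w \<longleftrightarrow>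
    (\<Sum>i<n. 3 / 2 * (ip d w (X i))\<^sup>2 / ip d w w) \<le> n * (1 / 2)" for X
    unfolding sum_divide_distrib[symmetric] sum_distrib_left[symmetric]
    using pos by (simp add: field_simps)
  have int: "integrable (gauss_vec d) (\<lambda>x. exp (- (3 / 2 * (ip d w x)\<^sup>2 / ip d w w)))"
    and val: "V.expectation (\<lambda>x. exp (- (3 / 2 * (ip d w x)\<^sup>2 / ip d w w))) = 1 / 2"
    using ip_gauss_vec_laplace[OF assms] by (simp_all only: has_bochner_integral_iff)
  show ?thesis
    using V.iid_sum_lower_tail[OF int, of n "1 / 2"] unfolding val eq gauss_samples_def by simp
qed

text \<open>The points of the cube [-1, 1]^d with coordinates in multiples of 1/m. Outside the first
  d indices all members take the same default value, which keeps the set finite.\<close>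

definition grid :: "nat \<Rightarrow> nat \<Rightarrow> (nat \<Rightarrow> real) set" where
  "grid m d = (\<lambda>z l. real_of_int (z l) / real m) ` (PiE {..<d} (\<lambda>_. {- int m..int m}))"

lemma finite_grid: "finite (grid m d)"
  unfolding grid_def by (intro finite_imageI finite_PiE) auto

lemma card_grid_le: "card (grid m d) \<le> (2 * m + 1) ^ d"
proof -
  have "card (grid m d) \<le> card (PiE {..<d} (\<lambda>_. {- int m..int m}))"
    unfolding grid_def by (intro card_image_le finite_PiE) auto
  also have "\<dots> = (2 * m + 1) ^ d"
    by (simp add: card_PiE nat_add_distrib nat_mult_distrib)
  finally show ?thesis .
qed

text \<open>A union bound. Grid points of norm 0 are left out because for them the bad event is the
  whole space.\<close>

lemma covariance_grid_tail:
  fixes d n m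
  defines "bad w \<equiv> {X \<in> space (gauss_samples n d). (\<Sum>i<n. (ip d w (X i))\<^sup>2) \<le> n / 3 * ip d w w}"
    and "D \<equiv> {w \<in> grid m d. ip d w w \<noteq> 0}"
  shows "(\<Union>w\<in>D. bad w) \<in> sets (gauss_samples n d)"
    and "measure (gauss_samples n d) (\<Union>w\<in>D. bad w) \<le> (2 * real m + 1) ^ d * (exp (1 / 2) / 2) ^ n"
proof -
  have fin: "finite D" unfolding D_def using finite_grid by simp
  have meas: "bad w \<in> sets (gauss_samples n d)" for w
    unfolding bad_def by measurable
  show "(\<Union>w\<in>D. bad w) \<in> sets (gauss_samples n d)"
    using fin meas by (intro sets.finite_UN) auto
  have "measure (gauss_samples n d) (\<Union>w\<in>D. bad w) \<le> (\<Sum>w\<in>D. measure (gauss_samples n d) (bad w))"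
    using fin meas by (intro measure_UNION_le) auto
  also have "\<dots> \<le> (\<Sum>w\<in>D. (exp (1 / 2) / 2) ^ n)"
    unfolding bad_def D_def by (intro sum_mono covariance_direction_tail) auto
  also have "\<dots> = real (card D) * (exp (1 / 2) / 2) ^ n" by simp
  also have "\<dots> \<le> (2 * real m + 1) ^ d * (exp (1 / 2) / 2) ^ n"
  proof (rule mult_right_mono)
    have "card D \<le> card (grid m d)" unfolding D_def by (intro card_mono finite_grid) auto
    then have "card D \<le> (2 * m + 1) ^ d" using card_grid_le by (rule order_trans)
    then have "real (card D) \<le> real ((2 * m + 1) ^ d)" by (rule of_nat_mono)
    then show "real (card D) \<le> (2 * real m + 1) ^ d" by (simp add: add.commute)
  qed simp
  finally show "measure (gauss_samples n d) (\<Union>w\<in>D. bad w) \<le> (2 * real m + 1) ^ d * (exp (1 / 2) / 2) ^ n" .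
qed

lemma ip_Cauchy_Schwarz: "(ip d x y)\<^sup>2 \<le> ip d x x * ip d y y"
  using Cauchy_Schwarz_ineq_sum[of x y "{..<d}"] by (simp add: ip_def power2_eq_square)

lemma covariance_lower_bound_unit:
  fixes d n :: nat
  assumes "0 < d" and u: "ip d u u = 1"
    and norms: "(\<Sum>i<n. ip d (X i) (X i)) \<le> n * (real d)\<^sup>2"
    and grid: "\<And>w. w \<in> grid (10 * d\<^sup>2) d \<Longrightarrow> ip d w w \<noteq> 0 \<Longrightarrow>
      n / 3 * ip d w w \<le> (\<Sum>i<n. (ip d w (X i))\<^sup>2)"
  shows "n / 10 \<le> (\<Sum>i<n. (ip d u (X i))\<^sup>2)"
proof -
  define m where "m = 10 * d\<^sup>2"
  have m: "0 < real m" using \<open>0 < d\<close> by (simp add: m_def)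
  define z where "z = restrict (\<lambda>l. \<lfloor>m * u l\<rfloor>) {..<d}"
  define v where "v l = real_of_int (z l) / m" for l
  define e where "e l = u l - v l" for l
  have abs_u: "\<bar>u l\<bar> \<le> 1" if "l < d" for l
  proof -
    have "(u l)\<^sup>2 \<le> ip d u u"
      unfolding ip_def power2_eq_square using that by (intro member_le_sum) auto
    then show ?thesis unfolding u by (simp add: abs_square_le_1)
  qed
  have "z l \<in> {- int m..int m}" if "l < d" for l
  proof -
    have "- real m \<le> m * u l" "m * u l \<le> real m"
      using abs_u[OF that] m mult_left_mono[of "- 1" "u l" "real m"] mult_left_mono[of "u l" 1 "real m"]
      by (auto simp: abs_le_iff)
    then have "- int m \<le> \<lfloor>m * u l\<rfloor>" "\<lfloor>m * u l\<rfloor> \<le> int m"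
      by linarith+
    then show ?thesis using that by (simp add: z_def)
  qed
  then have "z \<in> PiE {..<d} (\<lambda>_. {- int m..int m})" by (auto simp: z_def)
  then have v: "v \<in> grid (10 * d\<^sup>2) d"
    unfolding m_def[symmetric] grid_def v_def[abs_def] by (rule imageI)
  have "(e l)\<^sup>2 \<le> (1 / m)\<^sup>2" if "l < d" for l
  proof -
    have "m * e l = m * u l - \<lfloor>m * u l\<rfloor>"
      using that m by (simp add: e_def v_def z_def field_simps)
    then have "0 \<le> m * e l" "m * e l \<le> 1" by linarith+
    then have "0 \<le> e l" "e l \<le> 1 / m" using m by (auto simp: zero_le_mult_iff field_simps)
    then show ?thesis by (intro power_mono) auto
  qed
  then have "ip d e e \<le> (\<Sum>l<d. (1 / m)\<^sup>2)"
    unfolding ip_def power2_eq_square by (intro sum_mono) auto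
  then have "ip d e e \<le> d / (real m)\<^sup>2"
    by (simp add: power_divide)
  also have "\<dots> = 1 / (100 * (real d)\<^sup>2 * d)"
    using \<open>0 < d\<close> by (simp add: m_def power2_eq_square field_simps)
  finally have e: "ip d e e \<le> 1 / (100 * (real d)\<^sup>2 * d)" .
  have d1: "1 \<le> real d" using \<open>0 < d\<close> by simp
  have "ip d e e * (real d)\<^sup>2 \<le> 1 / (100 * (real d)\<^sup>2 * d) * (real d)\<^sup>2"
    using e by (intro mult_right_mono) auto
  also have "\<dots> = 1 / (100 * real d)" using \<open>0 < d\<close> by simp
  also have "\<dots> \<le> 1 / 100" using d1 by (simp add: field_simps)
  finally have "ip d e e * (real d)\<^sup>2 \<le> 1 / 100" .
  moreover have "ip d e e * 1 \<le> ip d e e * (real d)\<^sup>2"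
    using d1 by (intro mult_left_mono one_le_power ip_self_nonneg)
  ultimately have e1: "ip d e e \<le> 1 / 100" and e2: "ip d e e * (real d)\<^sup>2 \<le> 1 / 100" by auto
  have u_eq: "ip d u x = ip d v x + ip d e x" for x
    by (simp add: ip_def e_def sum.distrib[symmetric] algebra_simps)
  have v_norm: "3 / 4 \<le> ip d v v"
  proof -
    have "1 = (\<Sum>l<d. u l * u l)" using u by (simp add: ip_def)
    \<comment> \<open>Young's inequality with constants 5/4 and 5: as \<open>ip d e e\<close> is at
      most 1/100, it gives (1 - 5/100) * 4/5 = 0.76 for the squared norm of
      \<open>v\<close>.\<close>
    also have "\<dots> \<le> (\<Sum>l<d. 5 / 4 * (v l * v l) + 5 * (e l * e l))"
    proof (rule sum_mono)
      fix l
      have "0 \<le> (v l / 2 - 2 * e l)\<^sup>2" by simp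
      then show "u l * u l \<le> 5 / 4 * (v l * v l) + 5 * (e l * e l)"
        by (simp add: e_def power2_eq_square algebra_simps)
    qed
    also have "\<dots> = 5 / 4 * ip d v v + 5 * ip d e e"
      by (simp add: ip_def sum.distrib sum_distrib_left)
    finally show ?thesis using e1 by simp
  qed
  \<comment> \<open>In total n / 4 is at most twice the sum for \<open>u\<close> plus 2 n / 100, so
    that sum is at least 0.115 n.\<close>
  have "n / 3 * (3 / 4) \<le> n / 3 * ip d v v"
    using v_norm by (intro mult_left_mono) auto
  also have "\<dots> \<le> (\<Sum>i<n. (ip d v (X i))\<^sup>2)"
    using grid[OF v] v_norm by simp
  also have "\<dots> \<le> (\<Sum>i<n. 2 * (ip d u (X i))\<^sup>2 + 2 * (ip d e e * ip d (X i) (X i)))"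
  proof (rule sum_mono)
    fix i
    have "0 \<le> (ip d v (X i) + 2 * ip d e (X i))\<^sup>2" by simp
    then have "(ip d v (X i))\<^sup>2 \<le> 2 * (ip d u (X i))\<^sup>2 + 2 * (ip d e (X i))\<^sup>2"
      unfolding u_eq by (simp add: power2_eq_square algebra_simps)
    then show "(ip d v (X i))\<^sup>2 \<le> 2 * (ip d u (X i))\<^sup>2 + 2 * (ip d e e * ip d (X i) (X i))"
      using ip_Cauchy_Schwarz[of d e "X i"] by linarith
  qed
  also have "\<dots> = 2 * (\<Sum>i<n. (ip d u (X i))\<^sup>2) + 2 * (ip d e e * (\<Sum>i<n. ip d (X i) (X i)))"
    by (simp add: sum.distrib sum_distrib_left)
  also have "ip d e e * (\<Sum>i<n. ip d (X i) (X i)) \<le> ip d e e * (n * (real d)\<^sup>2)"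
    using norms ip_self_nonneg by (intro mult_left_mono)
  also have "ip d e e * (n * (real d)\<^sup>2) = n * (ip d e e * (real d)\<^sup>2)" by simp
  also have "n * (ip d e e * (real d)\<^sup>2) \<le> n * (1 / 100)"
    using e2 by (intro mult_left_mono) auto
  finally show ?thesis by simp
qed

lemma covariance_lower_bound:
  fixes d n :: nat
  assumes "0 < d"
    and norms: "(\<Sum>i<n. ip d (X i) (X i)) \<le> n * (real d)\<^sup>2"
    and grid: "\<And>w. w \<in> grid (10 * d\<^sup>2) d \<Longrightarrow> ip d w w \<noteq> 0 \<Longrightarrow>
      n / 3 * ip d w w \<le> (\<Sum>i<n. (ip d w (X i))\<^sup>2)"
  shows "n / 10 * ip d w w \<le> (\<Sum>i<n. (ip d w (X i))\<^sup>2)"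
proof (cases "ip d w w = 0")
  case True
  then show ?thesis by (simp add: sum_nonneg)
next
  case False
  then have pos: "0 < ip d w w" using ip_self_nonneg[of d w] by simp
  define c where "c = 1 / sqrt (ip d w w)"
  have c2: "c\<^sup>2 = 1 / ip d w w" using pos by (simp add: c_def power_divide)
  have "ip d (\<lambda>l. c * w l) (\<lambda>l. c * w l) = c\<^sup>2 * ip d w w"
    by (simp add: ip_scale_left ip_scale_right power2_eq_square)
  also have "\<dots> = 1" using pos by (simp add: c2)
  finally have "n / 10 \<le> (\<Sum>i<n. (ip d (\<lambda>l. c * w l) (X i))\<^sup>2)"
    by (rule covariance_lower_bound_unit[OF \<open>0 < d\<close> _ norms grid])
  also have "\<dots> = c\<^sup>2 * (\<Sum>i<n. (ip d w (X i))\<^sup>2)"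
    by (simp add: ip_scale_left power_mult_distrib sum_distrib_left)
  finally show ?thesis using pos by (simp add: c2 field_simps)
qed

text \<open>For d \<ge> 9 each factor of the grid count is at most d^4, and each sample contributes
  at most exp (-1/10). The exponent is therefore at most 4 d ln d - 10 d ln d, which is below - ln
  d.\<close>

lemma grid_union_bound_arith:
  assumes d: "9 \<le> d" and n: "100 * real d * ln (real d) \<le> real n"
  shows "(2 * real (10 * d\<^sup>2) + 1) ^ d * (exp (1 / 2) / 2) ^ n \<le> 1 / d"
proof -
  have "0 < real d" using d by simp
  have ln: "0 \<le> ln (real d)" using d by simp
  \<comment> \<open>exp (3/5) \<le> 2 follows by fifth powers, since e^3 \<le> 27 \<le> 32.\<close>
  have "(exp (3 / 5)) ^ 5 = exp (1 :: real) ^ 3"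
    by (simp add: exp_of_nat_mult[symmetric])
  also have "\<dots> \<le> 3 ^ 3" using exp_le by (intro power_mono) auto
  also have "\<dots> \<le> (2 :: real) ^ 5" by simp
  finally have "(exp (3 / 5)) ^ 5 \<le> (2 :: real) ^ 5" .
  then have "exp (3 / 5) \<le> (2 :: real)"
    using power_strict_mono[of 2 "exp (3 / 5 :: real)" 5] by linarith
  then have "exp (1 / 10) * exp (1 / 2) \<le> (2 :: real)"
    by (simp add: mult_exp_exp)
  then have base: "exp (1 / 2) / 2 \<le> exp (- (1 / 10) :: real)"
    by (simp add: exp_minus field_simps)
  have "2 * real (10 * d\<^sup>2) + 1 \<le> (real d) ^ 4"
  proof -
    have "81 * (real d)\<^sup>2 \<le> (real d)\<^sup>2 * (real d)\<^sup>2"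
      using d power_mono[of 9 "real d" 2] by (intro mult_right_mono) auto
    moreover have "1 \<le> (real d)\<^sup>2" using d by (intro one_le_power) auto
    moreover have "(real d)\<^sup>2 * (real d)\<^sup>2 = (real d) ^ 4" by (simp add: power_add[symmetric])
    ultimately show ?thesis by simp
  qed
  also have "(real d) ^ 4 = exp (4 * ln (real d))"
    using \<open>0 < real d\<close> exp_of_nat_mult[of 4 "ln (real d)"] by simp
  finally have count: "2 * real (10 * d\<^sup>2) + 1 \<le> exp (4 * ln (real d))" .
  have "(2 * real (10 * d\<^sup>2) + 1) ^ d * (exp (1 / 2) / 2) ^ n \<le>
    exp (4 * ln (real d)) ^ d * exp (- (1 / 10)) ^ n"
    using count base by (intro mult_mono power_mono) auto
  also have "\<dots> = exp (d * (4 * ln (real d)) + n * (- (1 / 10)))"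
    by (simp only: exp_add exp_of_nat_mult)
  also have "\<dots> \<le> exp (- ln (real d))"
  proof -
    have "1 * ln (real d) \<le> d * ln (real d)" using d ln by (intro mult_right_mono) auto
    then show ?thesis using n ln by simp
  qed
  also have "\<dots> = 1 / d" using \<open>0 < real d\<close> by (simp add: exp_minus inverse_eq_divide)
  finally show ?thesis .
qed

text \<open>Three bad events, for the sample norms, the labels and the grid directions, have
  probability at most 1/d each, which stays within 8/d.\<close>

lemma good_event:
  fixes k d n :: nat and Ws :: "nat \<Rightarrow> nat \<Rightarrow> real" and vs :: "nat \<Rightarrow> real"
  defines "N \<equiv> \<Sum>j<k. vs j * ip d (Ws j) (Ws j)"
  assumes d: "9 \<le> d" and n: "100 * real d * ln (real d) \<le> real n"
    and vs: "\<And>j. j < k \<Longrightarrow> 0 \<le> vs j"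
  shows "\<exists>A \<in> sets (gauss_samples n d). 1 - 8 / real d \<le> measure (gauss_samples n d) A \<and>
    (\<forall>X\<in>A. (\<forall>w. n / 10 * ip d w w \<le> (\<Sum>i<n. (ip d w (X i))\<^sup>2)) \<and>
      (\<Sum>i<n. (label k d Ws vs X i)\<^sup>2) \<le> 12 * real n * N\<^sup>2)"
proof -
  interpret S: prob_space "gauss_samples n d" by (rule prob_space_gauss_samples)
  \<comment> \<open>For d \<ge> 9 the logarithm is at least 1, hence n \<ge> 100 d, and this turns
    the label bound 35/n into 1/d.\<close>
  have "exp 1 \<le> real d" using exp_le d by linarith
  then have "1 \<le> ln (real d)" using d by (subst ln_ge_iff) auto
  then have "100 * real d * 1 \<le> 100 * real d * ln (real d)" by (intro mult_left_mono) auto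
  then have nd: "100 * real d \<le> n" using n by linarith
  have "0 < n" "0 < d" using nd d by auto
  define B1 where "B1 = {X \<in> space (gauss_samples n d). n * (real d)\<^sup>2 \<le> (\<Sum>i<n. ip d (X i) (X i))}"
  define B2 where "B2 = {X \<in> space (gauss_samples n d). 12 * real n * N\<^sup>2 < (\<Sum>i<n. (label k d Ws vs X i)\<^sup>2)}"
  define B3 where "B3 = (\<Union>w\<in>{w \<in> grid (10 * d\<^sup>2) d. ip d w w \<noteq> 0}.
    {X \<in> space (gauss_samples n d). (\<Sum>i<n. (ip d w (X i))\<^sup>2) \<le> n / 3 * ip d w w})"
  have meas: "B1 \<in> sets (gauss_samples n d)" "B2 \<in> sets (gauss_samples n d)" "B3 \<in> sets (gauss_samples n d)"
    unfolding B1_def B2_def B3_def by (measurable, measurable, rule covariance_grid_tail)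
  have "S.prob B1 \<le> 1 / d"
    unfolding B1_def by (rule sample_norm_tail[OF \<open>0 < n\<close> \<open>0 < d\<close>])
  moreover have "S.prob B2 \<le> 1 / d"
  proof -
    have "S.prob B2 \<le> 35 / n"
      unfolding B2_def N_def by (rule label_tail[OF vs \<open>0 < n\<close>])
    also have "\<dots> \<le> 1 / d" using nd \<open>0 < n\<close> \<open>0 < d\<close> by (simp add: field_simps)
    finally show ?thesis .
  qed
  moreover have "S.prob B3 \<le> 1 / d"
    unfolding B3_def using covariance_grid_tail(2) grid_union_bound_arith[OF d n] by (rule order_trans)
  moreover have "S.prob (B1 \<union> B2 \<union> B3) \<le> S.prob B1 + S.prob B2 + S.prob B3"
    using measure_Un_le[of "B1 \<union> B2" "gauss_samples n d" B3] measure_Un_le[of B1 "gauss_samples n d" B2] meas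
    by auto
  ultimately have "S.prob (B1 \<union> B2 \<union> B3) \<le> 3 * (1 / d)"
    by linarith
  also have "\<dots> \<le> 8 / d"
    by (simp add: divide_right_mono)
  finally have "1 - 8 / real d \<le> S.prob (space (gauss_samples n d) - (B1 \<union> B2 \<union> B3))"
    using meas by (subst S.prob_compl) auto
  moreover have "(\<forall>w. n / 10 * ip d w w \<le> (\<Sum>i<n. (ip d w (X i))\<^sup>2)) \<and>
      (\<Sum>i<n. (label k d Ws vs X i)\<^sup>2) \<le> 12 * real n * N\<^sup>2"
    if X: "X \<in> space (gauss_samples n d) - (B1 \<union> B2 \<union> B3)" for X
  proof (intro conjI allI)
    show "n / 10 * ip d w w \<le> (\<Sum>i<n. (ip d w (X i))\<^sup>2)" for w
    proof (rule covariance_lower_bound[OF \<open>0 < d\<close>])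
      show "(\<Sum>i<n. ip d (X i) (X i)) \<le> n * (real d)\<^sup>2"
        using X by (auto simp: B1_def)
      show "n / 3 * ip d w w \<le> (\<Sum>i<n. (ip d w (X i))\<^sup>2)"
        if "w \<in> grid (10 * d\<^sup>2) d" "ip d w w \<noteq> 0" for w
      proof -
        have "\<not> (\<Sum>i<n. (ip d w (X i))\<^sup>2) \<le> n / 3 * ip d w w"
          using X that unfolding B3_def by blast
        then show ?thesis by linarith
      qed
    qed
    show "(\<Sum>i<n. (label k d Ws vs X i)\<^sup>2) \<le> 12 * real n * N\<^sup>2"
      using X by (auto simp: B2_def)
  qed
  ultimately show ?thesis
    using meas by (intro bexI[of _ "space (gauss_samples n d) - (B1 \<union> B2 \<union> B3)"]) auto
qed

section \<open>Choice of the constants and treatment of small dimensions\<close>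

theorem theorem2p2:
  "\<exists>c>0. \<exists>C>0. \<exists>\<gamma>>0. \<forall>(k::nat) (d::nat) (Ws::nat \<Rightarrow> nat \<Rightarrow> real) (vs::nat \<Rightarrow> real) (\<nu>::real) (n::nat).
     k > d \<and> sigma_min k d Ws > 0 \<and> (\<forall>j<k. vs j \<ge> 0) \<and> \<nu> > 0 \<and>
     c * real d * ln (real d) \<le> real n \<and> real n \<le> C * (real d)\<^sup>2 \<longrightarrow>
     (\<exists>A \<in> sets (gauss_samples n d).
        measure (gauss_samples n d) A \<ge> 1 - 12 * real d * exp (- \<gamma> * real d) - 8 / real d \<and>
        (\<forall>X \<in> A. \<forall>\<epsilon>g \<ge> 0. \<forall>\<epsilon>H \<ge> 0. \<forall>W.
           grad_frob k d (loss k d n Ws vs \<nu> X) W \<le> \<epsilon>g \<and>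
           hessian_ge k d (loss k d n Ws vs \<nu> X) W \<epsilon>H \<longrightarrow>
           loss k d n Ws vs \<nu> X W \<le>
             \<epsilon>g / sqrt \<nu> * max (sqrt (1 + 14 * nuclear_norm d d (WtDW k Ws vs))) (4 * \<epsilon>g / sqrt \<nu>)
             + \<epsilon>H / (2 * \<nu>) * nuclear_norm d d (WtDW k Ws vs)))"
proof (rule exI[of _ 100], intro conjI exI[of _ 1] allI impI)
  \<comment> \<open>The constants are c = 100, which beats the grid count in the union bound, and C
    = \<gamma> = 1.\<close>
  fix k d n :: nat and Ws :: "nat \<Rightarrow> nat \<Rightarrow> real" and vs :: "nat \<Rightarrow> real" and \<nu> :: real
  assume asm: "k > d \<and> sigma_min k d Ws > 0 \<and> (\<forall>j<k. vs j \<ge> 0) \<and> \<nu> > 0 \<and>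
     100 * real d * ln (real d) \<le> real n \<and> real n \<le> 1 * (real d)\<^sup>2"
  then have "d < k" and vs: "\<And>j. j < k \<Longrightarrow> 0 \<le> vs j" and "0 < \<nu>"
    and n: "100 * real d * ln (real d) \<le> real n" and n_le: "real n \<le> (real d)\<^sup>2" by auto
  interpret S: prob_space "gauss_samples n d" by (rule prob_space_gauss_samples)
  define N where "N = (\<Sum>j<k. vs j * ip d (Ws j) (Ws j))"
  let ?nn = "nuclear_norm d d (WtDW k Ws vs)"
  have N0: "0 \<le> N" unfolding N_def using vs ip_self_nonneg by (intro sum_nonneg) auto
  have N_le: "N \<le> ?nn" unfolding N_def by (rule trace_le_nuclear_norm_WtDW[OF vs])
  consider "d = 0" | "0 < d" "d < 9" | "9 \<le> d" by linarith
  then show "\<exists>A \<in> sets (gauss_samples n d).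
        measure (gauss_samples n d) A \<ge> 1 - 12 * real d * exp (- 1 * real d) - 8 / real d \<and>
        (\<forall>X \<in> A. \<forall>\<epsilon>g \<ge> 0. \<forall>\<epsilon>H \<ge> 0. \<forall>W.
           grad_frob k d (loss k d n Ws vs \<nu> X) W \<le> \<epsilon>g \<and>
           hessian_ge k d (loss k d n Ws vs \<nu> X) W \<epsilon>H \<longrightarrow>
           loss k d n Ws vs \<nu> X W \<le>
             \<epsilon>g / sqrt \<nu> * max (sqrt (1 + 14 * ?nn)) (4 * \<epsilon>g / sqrt \<nu>) + \<epsilon>H / (2 * \<nu>) * ?nn)"
  proof cases
    case 1
    then have "n = 0" using n_le by simp
    then have "loss k d n Ws vs \<nu> X W = 0" for X W by (simp add: loss_def)
    moreover have "0 \<le> \<epsilon>g / sqrt \<nu> * max (sqrt (1 + 14 * ?nn)) (4 * \<epsilon>g / sqrt \<nu>) + \<epsilon>H / (2 * \<nu>) * ?nn"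
      if "0 \<le> \<epsilon>g" "0 \<le> \<epsilon>H" for \<epsilon>g \<epsilon>H
      using that N0 N_le \<open>0 < \<nu>\<close> by (intro add_nonneg_nonneg mult_nonneg_nonneg) (auto simp: le_max_iff_disj)
    ultimately show ?thesis
      using 1 S.prob_space by (intro bexI[of _ "space (gauss_samples n d)"]) auto
  next
    case 2
    then have "1 \<le> 8 / real d" by (simp add: field_simps)
    moreover have "0 \<le> 12 * real d * exp (- 1 * real d)" by simp
    ultimately have "1 - 12 * real d * exp (- 1 * real d) - 8 / real d \<le> S.prob {}"
      unfolding measure_empty by linarith
    then show ?thesis by (intro bexI[OF _ sets.empty_sets] conjI ballI) (assumption, erule emptyE)
  next
    case 3
    have "\<exists>A \<in> sets (gauss_samples n d). 1 - 8 / real d \<le> measure (gauss_samples n d) A \<and>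
      (\<forall>X\<in>A. (\<forall>w. n / 10 * ip d w w \<le> (\<Sum>i<n. (ip d w (X i))\<^sup>2)) \<and>
        (\<Sum>i<n. (label k d Ws vs X i)\<^sup>2) \<le> 12 * real n * N\<^sup>2)"
      unfolding N_def by (rule good_event[OF 3 n vs])
    then obtain A where A: "A \<in> sets (gauss_samples n d)" "1 - 8 / real d \<le> measure (gauss_samples n d) A"
      and good: "\<forall>X\<in>A. (\<forall>w. n / 10 * ip d w w \<le> (\<Sum>i<n. (ip d w (X i))\<^sup>2)) \<and>
        (\<Sum>i<n. (label k d Ws vs X i)\<^sup>2) \<le> 12 * real n * N\<^sup>2"
      by (elim bexE conjE)
    have "0 < ln (real d)" using 3 by simp
    then have "0 < 100 * real d * ln (real d)" using 3 by simp
    then have "0 < n" using n by linarith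
    show ?thesis
    proof (intro bexI[OF _ A(1)] conjI ballI allI impI)
      have "0 \<le> 12 * real d * exp (- 1 * real d)" by simp
      then show "measure (gauss_samples n d) A \<ge> 1 - 12 * real d * exp (- 1 * real d) - 8 / real d"
        using A(2) by linarith
      fix X \<epsilon>g \<epsilon>H W
      assume X: "X \<in> A" and eps: "(0::real) \<le> \<epsilon>g" "(0::real) \<le> \<epsilon>H"
        and stat: "grad_frob k d (loss k d n Ws vs \<nu> X) W \<le> \<epsilon>g \<and> hessian_ge k d (loss k d n Ws vs \<nu> X) W \<epsilon>H"
      have cov: "n / 10 * ip d w w \<le> (\<Sum>i<n. (ip d w (X i))\<^sup>2)" for w
        using good X by blast
      have lab: "(\<Sum>i<n. (label k d Ws vs X i)\<^sup>2) \<le> 12 * real n * N\<^sup>2"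
        using good X by blast
      have "loss k d n Ws vs \<nu> X W \<le>
          \<epsilon>g / sqrt \<nu> * max (sqrt (1 + 14 * N)) (4 * \<epsilon>g / sqrt \<nu>) + \<epsilon>H / (2 * \<nu>) * N"
        unfolding N_def
        by (rule approx_stationary_loss_bound[OF \<open>d < k\<close> \<open>0 < n\<close> \<open>0 < \<nu>\<close> eps vs cov
              lab[unfolded N_def] conjunct1[OF stat] conjunct2[OF stat]])
      \<comment> \<open>The bound is monotone in N, so the trace may be replaced by the nuclear
        norm.\<close>
      also have "\<dots> \<le> \<epsilon>g / sqrt \<nu> * max (sqrt (1 + 14 * ?nn)) (4 * \<epsilon>g / sqrt \<nu>) + \<epsilon>H / (2 * \<nu>) * ?nn"
        using N_le eps \<open>0 < \<nu>\<close> by (intro add_mono mult_left_mono max.mono real_sqrt_le_mono) simp_all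
      finally show "loss k d n Ws vs \<nu> X W \<le>
          \<epsilon>g / sqrt \<nu> * max (sqrt (1 + 14 * ?nn)) (4 * \<epsilon>g / sqrt \<nu>) + \<epsilon>H / (2 * \<nu>) * ?nn" .
    qed
  qed
qed simp_all

end
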